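(* Assume each $f_i$ is differentiable with $\|\nabla f_i(x)-\nabla f_i(y)\|\le L\|x-y\|$ for all $x,y\in\mathbb{R}^d$. Run the SCSG algorithm with time-varying batch sizes $$b_j\equiv 1,\qquad B_j=\min\left\{\lceil j^{3/2}\rceil,\,n\right\},\qquad \eta_j=\frac{1}{6LB_j^{2/3}}.$$ Then for $\epsilon>0$, $$\mathbb{E}\,C_{\mathrm{comp}}(\epsilon)=O\left(\min\left\{\frac{1}{\epsilon^{5/3}}\left[(L\Delta_f)^{5/3}+(\mathcal{H}^* )^{5/3}\log^5\left(\frac{\mathcal{H}^*}{\epsilon}\right)\right],\ n^{5/3}\right\}+\frac{n^{2/3}}{\epsilon}\left(L\Delta_f+\mathcal{H}^*\log n\right)\right).$$
   Context: Let $f(x)=\frac1n\sum_{i=1}^n f_i(x)$ on $\mathbb{R}^d$, $\|\cdot\|$ the Euclidean norm, $0<L<\infty$, $f^*=\inf_x f(x)>-\infty$, $\Delta_f=f(\tilde{x}_0)-f^*$, and $\mathcal{H}^*=\sup_x \frac1n\sum_{i=1}^n\|\nabla f_i(x)-\nabla f(x)\|^2<\infty$. For $\mathcal{I}\subset\{1,\dots,n\}$ write $\nabla f_{\mathcal{I}}(x)=\frac{1}{|\mathcal{I}|}\sum_{i\in\mathcal{I}}\nabla f_i(x)$. $N\sim\mathrm{Geom}(\rho)$ means $P(N=k)=\rho^k(1-\rho)$, $k=0,1,2,\dots$. SCSG algorithm. Inputs: number of epochs $T$, deterministic initial iterate $\tilde{x}_0\in\mathbb{R}^d$, stepsizes $\eta_j>0$,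 batch sizes $B_j\in\{1,\dots,n\}$, mini-batch sizes $b_j\in\{1,\dots,n\}$. For $j=1,\dots,T$: sample $\mathcal{I}_j\subset\{1,\dots,n\}$ uniformly among subsets of size $B_j$; set $g_j=\nabla f_{\mathcal{I}_j}(\tilde{x}_{j-1})$ and $x^{(j)}_0=\tilde{x}_{j-1}$; draw $N_j\sim\mathrm{Geom}(B_j/(B_j+b_j))$; for $k=1,\dots,N_j$ sample $\tilde{\mathcal{I}}_{k-1}\subset\{1,\dots,n\}$ uniformly among subsets of size $b_j$, set $\nu^{(j)}_{k-1}=\nabla f_{\tilde{\mathcal{I}}_{k-1}}(x^{(j)}_{k-1})-\nabla f_{\tilde{\mathcal{I}}_{k-1}}(x^{(j)}_0)+g_j$ and $x^{(j)}_k=x^{(j)}_{k-1}-\eta_j\nu^{(j)}_{k-1}$; finally set $\tilde{x}_j=x^{(j)}_{N_j}$. All random draws are independent. The output $\tilde{x}_T^*$ is sampled (independently of everything else) from $(\tilde{x}_j)_{j=1}^T$ with $P(\tilde{x}_T^*=\tilde{x}_j)\propto \eta_jB_j/b_j$. Complexity. Computing $\nabla f_{\mathcal{I}}(x)$ costs $|\mathcal{I}|$ units, and epoch $j$ is charged $B_j+b_jN_j$ units (expected cost $2B_j$). Let $T(\epsilon)=\min\{T:\ \mathbb{E}\|\nabla f(\tilde{x}_{T'}^* )\|^2\le\epsilon\text{ for all }T'\ge T\}$. $C_{\mathrm{comp}}(\epsilon)$ is the cost of reaching an $\epsilon$-accurate solution, i.e. the total cost of the first $T(\epsilon)$ epochs,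 so $\mathbb{E}\,C_{\mathrm{comp}}(\epsilon)\le 2\sum_{j=1}^{T(\epsilon)}B_j$. Conventions: $O(X)$ means at most $C\max\{X,1\}$ with $C$ an absolute constant; $\log(\mathcal{H}^*/\epsilon)$ is read as $\max\{\log(\mathcal{H}^*/\epsilon),1\}$, with the corresponding term equal to $0$ if $\mathcal{H}^*=0$. *)

theory Defs
  imports "HOL-Probability.Probability" "HOL-Library.Monad_Syntax"
begin

text \<open>
  The dimension d is a term rather than a type, so that the absolute constant of the complexity
  bound can be quantified outside of it: a point of Euclidean d-space is a function on the natural
  numbers that vanishes from index d on. Objective functions are only ever considered on \<open>Rd d\<close>.
\<close>

definition Rd :: "nat \<Rightarrow> (nat \<Rightarrow> real) set" where
  "Rd d = {x. \<forall>m\<ge>d. x m = 0}"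

definition ip :: "nat \<Rightarrow> (nat \<Rightarrow> real) \<Rightarrow> (nat \<Rightarrow> real) \<Rightarrow> real" where
  "ip d x y = (\<Sum>m<d. x m * y m)"

definition enorm :: "nat \<Rightarrow> (nat \<Rightarrow> real) \<Rightarrow> real" where
  "enorm d x = L2_set x {..<d}"

text \<open>Frechet differentiability at x, the derivative being represented by the vector g.\<close>

definition has_gradient ::
  "nat \<Rightarrow> ((nat \<Rightarrow> real) \<Rightarrow> real) \<Rightarrow> (nat \<Rightarrow> real) \<Rightarrow> (nat \<Rightarrow> real) \<Rightarrow> bool" where
  "has_gradient d h g x \<longleftrightarrow> g \<in> Rd d \<and>
     (\<forall>e>0. \<exists>\<delta>>0. \<forall>y\<in>Rd d. enorm d (\<lambda>m. y m - x m) < \<delta> \<longrightarrow>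
        \<bar>h y - h x - ip d g (\<lambda>m. y m - x m)\<bar> \<le> e * enorm d (\<lambda>m. y m - x m))"

definition differentiable_at :: "nat \<Rightarrow> ((nat \<Rightarrow> real) \<Rightarrow> real) \<Rightarrow> (nat \<Rightarrow> real) \<Rightarrow> bool" where
  "differentiable_at d h x \<longleftrightarrow> (\<exists>g. has_gradient d h g x)"

definition grad :: "nat \<Rightarrow> ((nat \<Rightarrow> real) \<Rightarrow> real) \<Rightarrow> (nat \<Rightarrow> real) \<Rightarrow> (nat \<Rightarrow> real)" where
  "grad d h x = (THE g. has_gradient d h g x)"

definition objective :: "nat \<Rightarrow> (nat \<Rightarrow> (nat \<Rightarrow> real) \<Rightarrow> real) \<Rightarrow> (nat \<Rightarrow> real) \<Rightarrow> real" where
  "objective n f x = (\<Sum>i=1..n. f i x) / real n"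

definition batch_grad ::
  "nat \<Rightarrow> (nat \<Rightarrow> (nat \<Rightarrow> real) \<Rightarrow> real) \<Rightarrow> nat set \<Rightarrow> (nat \<Rightarrow> real) \<Rightarrow> (nat \<Rightarrow> real)" where
  "batch_grad d f I x = (\<lambda>m. (\<Sum>i\<in>I. grad d (f i) x m) / real (card I))"

definition grad_variance :: "nat \<Rightarrow> nat \<Rightarrow> (nat \<Rightarrow> (nat \<Rightarrow> real) \<Rightarrow> real) \<Rightarrow> (nat \<Rightarrow> real) \<Rightarrow> real" where
  "grad_variance d n f x =
     (\<Sum>i=1..n. (enorm d (\<lambda>m. grad d (f i) x m - grad d (objective n f) x m))\<^sup>2) / real n"

definition H_star :: "nat \<Rightarrow> nat \<Rightarrow> (nat \<Rightarrow> (nat \<Rightarrow> real) \<Rightarrow> real) \<Rightarrow> real" where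
  "H_star d n f = (SUP x\<in>Rd d. grad_variance d n f x)"

definition Delta_f :: "nat \<Rightarrow> nat \<Rightarrow> (nat \<Rightarrow> (nat \<Rightarrow> real) \<Rightarrow> real) \<Rightarrow> (nat \<Rightarrow> real) \<Rightarrow> real" where
  "Delta_f d n f x0 = objective n f x0 - (INF x\<in>Rd d. objective n f x)"

definition uniform_subset :: "nat \<Rightarrow> nat \<Rightarrow> nat set pmf" where
  "uniform_subset n b = pmf_of_set {I. I \<subseteq> {1..n} \<and> card I = b}"

text \<open>Law of the iterate after k inner steps, started at x0 with large-batch gradient g.\<close>

primrec scsg_inner ::
  "nat \<Rightarrow> nat \<Rightarrow> (nat \<Rightarrow> (nat \<Rightarrow> real) \<Rightarrow> real) \<Rightarrow> real \<Rightarrow> nat \<Rightarrow>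
   (nat \<Rightarrow> real) \<Rightarrow> (nat \<Rightarrow> real) \<Rightarrow> nat \<Rightarrow> (nat \<Rightarrow> real) pmf" where
  "scsg_inner d n f \<eta> b g x0 0 = return_pmf x0"
| "scsg_inner d n f \<eta> b g x0 (Suc k) = do {
     x \<leftarrow> scsg_inner d n f \<eta> b g x0 k;
     I \<leftarrow> uniform_subset n b;
     return_pmf (\<lambda>m. x m - \<eta> * (batch_grad d f I x m - batch_grad d f I x0 m + g m))
   }"

text \<open>
  Joint law of the final iterate of an epoch and its number N of inner steps. The success
  parameter of \<^const>\<open>geometric_pmf\<close> is \<open>1 - \<rho>\<close> in terms of the convention
  \<open>P(N = k) = \<rho>^k (1 - \<rho>)\<close>; here \<open>\<rho> = B / (B + b)\<close>.
\<close>

definition scsg_epoch ::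
  "nat \<Rightarrow> nat \<Rightarrow> (nat \<Rightarrow> (nat \<Rightarrow> real) \<Rightarrow> real) \<Rightarrow> real \<Rightarrow> nat \<Rightarrow> nat \<Rightarrow>
   (nat \<Rightarrow> real) \<Rightarrow> ((nat \<Rightarrow> real) \<times> nat) pmf" where
  "scsg_epoch d n f \<eta> B b x0 = do {
     I \<leftarrow> uniform_subset n B;
     N \<leftarrow> geometric_pmf (1 - real B / (real B + real b));
     x \<leftarrow> scsg_inner d n f \<eta> b (batch_grad d f I x0) x0 N;
     return_pmf (x, N)
   }"

text \<open>
  Law of the trajectory \<open>\<omega>\<close> of the first T epochs: for \<open>1 \<le> j \<le> T\<close>, \<open>\<omega> j\<close> is the pair of the
  j-th outer iterate and the j-th number of inner steps. The iterate at j = 0 is the initial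
  point; the other entries are dummies.
\<close>

primrec scsg_run ::
  "nat \<Rightarrow> nat \<Rightarrow> (nat \<Rightarrow> (nat \<Rightarrow> real) \<Rightarrow> real) \<Rightarrow> (nat \<Rightarrow> real) \<Rightarrow> (nat \<Rightarrow> nat) \<Rightarrow> (nat \<Rightarrow> nat) \<Rightarrow>
   (nat \<Rightarrow> real) \<Rightarrow> nat \<Rightarrow> (nat \<Rightarrow> (nat \<Rightarrow> real) \<times> nat) pmf" where
  "scsg_run d n f \<eta> B b x0 0 = return_pmf (\<lambda>_. (x0, 0))"
| "scsg_run d n f \<eta> B b x0 (Suc T) = do {
     \<omega> \<leftarrow> scsg_run d n f \<eta> B b x0 T;
     p \<leftarrow> scsg_epoch d n f (\<eta> (Suc T)) (B (Suc T)) (b (Suc T)) (fst (\<omega> T));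
     return_pmf (fun_upd \<omega> (Suc T) p)
   }"

text \<open>Only meaningful for \<open>T \<ge> 1\<close>: there is no output before the first epoch.\<close>

definition output_index :: "(nat \<Rightarrow> real) \<Rightarrow> (nat \<Rightarrow> nat) \<Rightarrow> (nat \<Rightarrow> nat) \<Rightarrow> nat \<Rightarrow> nat pmf" where
  "output_index \<eta> B b T = embed_pmf (\<lambda>j. if j \<in> {1..T}
     then (\<eta> j * real (B j) / real (b j)) / (\<Sum>i=1..T. \<eta> i * real (B i) / real (b i)) else 0)"

definition scsg_output ::
  "nat \<Rightarrow> nat \<Rightarrow> (nat \<Rightarrow> (nat \<Rightarrow> real) \<Rightarrow> real) \<Rightarrow> (nat \<Rightarrow> real) \<Rightarrow> (nat \<Rightarrow> nat) \<Rightarrow> (nat \<Rightarrow> nat) \<Rightarrow>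
   (nat \<Rightarrow> real) \<Rightarrow> nat \<Rightarrow> (nat \<Rightarrow> real) pmf" where
  "scsg_output d n f \<eta> B b x0 T = do {
     \<omega> \<leftarrow> scsg_run d n f \<eta> B b x0 T;
     j \<leftarrow> output_index \<eta> B b T;
     return_pmf (fst (\<omega> j))
   }"

text \<open>
  Expectations are taken in the extended nonnegative reals, so that a non-integrable quantity has
  expectation \<open>\<infinity>\<close> instead of a default value.
\<close>

definition expected_sq_grad ::
  "nat \<Rightarrow> nat \<Rightarrow> (nat \<Rightarrow> (nat \<Rightarrow> real) \<Rightarrow> real) \<Rightarrow> (nat \<Rightarrow> real) \<Rightarrow> (nat \<Rightarrow> nat) \<Rightarrow> (nat \<Rightarrow> nat) \<Rightarrow>
   (nat \<Rightarrow> real) \<Rightarrow> nat \<Rightarrow> ennreal" where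
  "expected_sq_grad d n f \<eta> B b x0 T =
     (\<integral>\<^sup>+x. ennreal ((enorm d (grad d (objective n f) x))\<^sup>2)
        \<partial>measure_pmf (scsg_output d n f \<eta> B b x0 T))"

text \<open>\<open>T(\<epsilon>)\<close>; its value is \<open>\<infinity>\<close> if there is no such T.\<close>

definition T_eps ::
  "nat \<Rightarrow> nat \<Rightarrow> (nat \<Rightarrow> (nat \<Rightarrow> real) \<Rightarrow> real) \<Rightarrow> (nat \<Rightarrow> real) \<Rightarrow> (nat \<Rightarrow> nat) \<Rightarrow> (nat \<Rightarrow> nat) \<Rightarrow>
   (nat \<Rightarrow> real) \<Rightarrow> real \<Rightarrow> enat" where
  "T_eps d n f \<eta> B b x0 \<epsilon> =
     (INF T\<in>{T. T \<ge> 1 \<and> (\<forall>T'\<ge>T. expected_sq_grad d n f \<eta> B b x0 T' \<le> ennreal \<epsilon>)}. enat T)"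

definition total_cost ::
  "(nat \<Rightarrow> nat) \<Rightarrow> (nat \<Rightarrow> nat) \<Rightarrow> nat \<Rightarrow> (nat \<Rightarrow> (nat \<Rightarrow> real) \<times> nat) \<Rightarrow> nat" where
  "total_cost B b T \<omega> = (\<Sum>j=1..T. B j + b j * snd (\<omega> j))"

definition expected_comp_cost ::
  "nat \<Rightarrow> nat \<Rightarrow> (nat \<Rightarrow> (nat \<Rightarrow> real) \<Rightarrow> real) \<Rightarrow> (nat \<Rightarrow> real) \<Rightarrow> (nat \<Rightarrow> nat) \<Rightarrow> (nat \<Rightarrow> nat) \<Rightarrow>
   (nat \<Rightarrow> real) \<Rightarrow> real \<Rightarrow> ennreal" where
  "expected_comp_cost d n f \<eta> B b x0 \<epsilon> =
     (case T_eps d n f \<eta> B b x0 \<epsilon> of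
        enat T \<Rightarrow> (\<integral>\<^sup>+\<omega>. of_nat (total_cost B b T \<omega>) \<partial>measure_pmf (scsg_run d n f \<eta> B b x0 T))
      | \<infinity> \<Rightarrow> \<infinity>)"

definition batch_size :: "nat \<Rightarrow> nat \<Rightarrow> nat" where
  "batch_size n j = min (nat \<lceil>real j powr (3/2)\<rceil>) n"

definition minibatch_size :: "nat \<Rightarrow> nat" where
  "minibatch_size j = 1"

definition step_size :: "real \<Rightarrow> nat \<Rightarrow> nat \<Rightarrow> real" where
  "step_size L n j = 1 / (6 * L * real (batch_size n j) powr (2/3))"

text \<open>
  The logarithm of \<open>H / \<epsilon>\<close> is truncated below at 1. For \<open>H = 0\<close> its term vanishes, because
  \<open>0 powr (5/3) = 0\<close>.
\<close>

definition complexity_bound :: "nat \<Rightarrow> real \<Rightarrow> real \<Rightarrow> real \<Rightarrow> real \<Rightarrow> real" where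
  "complexity_bound n L \<Delta> H \<epsilon> =
     min (1 / \<epsilon> powr (5/3) *
            ((L * \<Delta>) powr (5/3) + H powr (5/3) * (max (ln (H / \<epsilon>)) 1) ^ 5))
         (real n powr (5/3))
     + real n powr (2/3) / \<epsilon> * (L * \<Delta> + H * ln (real n))"

end

theory Submission
  imports Defs
begin

text \<open>
  Write \<open>u = B\<^sup>1\<^sup>/\<^sup>3\<close> for the batch size \<open>B\<close> of an epoch started at \<open>x0\<close>, so that the step size is
  \<open>\<eta> = 1 / (6 L u\<^sup>2)\<close>, and let \<open>e\<close> be the error of its large-batch gradient. The inner loop uses
  gradient estimates with mean \<open>\<nabla>f(x) + e\<close> and with variance at most \<open>L\<^sup>2 |x - x0|\<^sup>2\<close>. Smoothness controls
  the change of the optimality gap by this variance, hence by the drift \<open>|x - x0|\<^sup>2\<close>. The drift in turn grows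
  by a factor of about \<open>1 + 1/(2 B)\<close> per step, up to a multiple of \<open>|\<nabla>f(x) + e|\<^sup>2\<close> that the decrease of the
  gap pays for. Since the loop stops after a geometric number \<open>N\<close> of
  steps with mean \<open>B\<close>, the potential \<open>\<Phi>(x) = f(x) - f\<^sup>* + c |x - x0|\<^sup>2\<close> may be allowed to grow by
  the factor \<open>1 + 1/B\<close> in each step: after discounting by the probability of survival, the
  growth telescopes away. With \<open>c = L / (12 u)\<close> the drift of one step is absorbed (\<open>one_step\<close>), and
  the telescoping (\<open>nn_integral_geometric_le\<close>) yields
  \<open>E (f(x_N) - f\<^sup>*) + (B \<eta> / 2) E |\<nabla>f(x_N)|\<^sup>2 \<le> f(x0) - f\<^sup>* + (B \<eta> / 2) E |e|\<^sup>2\<close> (\<open>epoch_bound\<close>).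
  All potentials are nonnegative, so the argument runs in the extended nonnegative reals and
  integrability of the iterates never has to be established beforehand.

  For a sample without replacement, \<open>E |e|\<^sup>2 \<le> H\<^sup>* / B\<close>, and \<open>e = 0\<close> if \<open>B = n\<close>
  (\<open>batch_gradient_error\<close>). Adding up the epochs, whose output weights are proportional to the
  coefficients \<open>B \<eta>\<close>, gives (\<open>expected_sq_grad_bound\<close>)
  \<open>E |\<nabla>f(output)|\<^sup>2 \<le> (12 L \<Delta> + H\<^sup>* \<Sum> [B_j < n] B_j\<^sup>-\<^sup>2\<^sup>/\<^sup>3) / \<Sum> B_j\<^sup>1\<^sup>/\<^sup>3\<close>.

  For \<open>B_j = min \<lceil>j\<^sup>3\<^sup>/\<^sup>2\<rceil> n\<close> put \<open>y = min T\<^sup>3\<^sup>/\<^sup>2 n\<close>. The error sum is a truncated harmonic sum, at most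
  \<open>1 + (2/3) ln y\<close>, and the sum of the weights is at least \<open>T y\<^sup>1\<^sup>/\<^sup>3 / 2\<close>. Let \<open>Y\<close> be a value of \<open>y\<close>
  from which on the resulting bound is at most \<open>\<epsilon>\<close>; up to constants
  \<open>Y = (L \<Delta> + H\<^sup>* log (H\<^sup>*/\<epsilon>)) / \<epsilon>\<close>. If \<open>Y \<le> n\<close>, then \<open>Y\<^sup>2\<^sup>/\<^sup>3\<close> epochs suffice, at a cost of order
  \<open>Y\<^sup>5\<^sup>/\<^sup>3 \<le> n\<^sup>5\<^sup>/\<^sup>3\<close>. Otherwise the batch size is eventually \<open>n\<close>: reaching it costs \<open>n\<^sup>5\<^sup>/\<^sup>3 \<le> Y\<^sup>5\<^sup>/\<^sup>3\<close>, and from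
  there on the accuracy decays like \<open>1/T\<close>, which accounts for the term with \<open>n\<^sup>2\<^sup>/\<^sup>3 / \<epsilon>\<close>
  (\<open>complexity_estimate\<close>).
\<close>

section \<open>Gradients and smoothness\<close>

definition sqn :: "nat \<Rightarrow> (nat \<Rightarrow> real) \<Rightarrow> real" where
  "sqn d x = (\<Sum>m<d. (x m)\<^sup>2)"

lemma enorm_sq: "(enorm d x)\<^sup>2 = sqn d x"
  by (simp add: enorm_def sqn_def L2_set_def sum_nonneg)

lemma enorm_nonneg [simp]: "0 \<le> enorm d x"
  by (simp add: enorm_def)

lemma sqn_nonneg [simp]: "0 \<le> sqn d x"
  by (simp add: sqn_def sum_nonneg)

lemma ip_scale_right: "ip d g (\<lambda>m. t * v m) = t * ip d g v"
  by (simp add: ip_def sum_distrib_left mult_ac)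

lemma enorm_scale: "enorm d (\<lambda>m. t * v m) = \<bar>t\<bar> * enorm d v"
  by (simp add: enorm_def L2_set_def power_mult_distrib sum_distrib_left[symmetric] real_sqrt_mult)

lemma ip_le_enorm: "ip d x y \<le> enorm d x * enorm d y"
proof -
  have "ip d x y \<le> (\<Sum>m<d. \<bar>x m\<bar> * \<bar>y m\<bar>)"
    unfolding ip_def by (intro sum_mono) (metis abs_ge_self abs_mult)
  also have "\<dots> \<le> enorm d x * enorm d y"
    unfolding enorm_def by (rule L2_set_mult_ineq)
  finally show ?thesis .
qed

lemma enorm_le_iff_sqn: "0 \<le> c \<Longrightarrow> enorm d x \<le> c * enorm d y \<longleftrightarrow> sqn d x \<le> c\<^sup>2 * sqn d y"
  by (simp flip: enorm_sq power_mult_distrib)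

text \<open>
  Restricting to a line turns the gradient into an ordinary derivative, so that uniqueness of
  the gradient and the descent inequality reduce to one-variable calculus.
\<close>

lemma has_gradient_line:
  assumes g: "has_gradient d h g (\<lambda>m. x m + t * v m)" and x: "x \<in> Rd d" and v: "v \<in> Rd d"
  shows "((\<lambda>s. h (\<lambda>m. x m + s * v m)) has_real_derivative ip d g v) (at t)"
proof -
  define z where "z = (\<lambda>s::real. (\<lambda>m. x m + s * v m))"
  have zR: "z s \<in> Rd d" for s using x v by (simp add: z_def Rd_def)
  have diff: "(\<lambda>m. z s m - z t m) = (\<lambda>m. (s - t) * v m)" for s
    by (auto simp: z_def algebra_simps)
  define V where "V = 1 + enorm d v"
  have V: "V > 0" "enorm d v \<le> V" using enorm_nonneg[of d v] by (auto simp: V_def simp del: enorm_nonneg)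
  have "((\<lambda>s. h (z s)) has_derivative (*) (ip d g v)) (at t)"
    unfolding has_derivative_at_alt
  proof (intro conjI allI impI)
    show "bounded_linear ((*) (ip d g v))" by (rule bounded_linear_mult_right)
    fix e :: real assume e: "e > 0"
    then have "e / V > 0" using V by simp
    then obtain \<delta> where \<delta>: "\<delta> > 0" and D: "\<And>y. y \<in> Rd d \<Longrightarrow> enorm d (\<lambda>m. y m - z t m) < \<delta> \<Longrightarrow>
        \<bar>h y - h (z t) - ip d g (\<lambda>m. y m - z t m)\<bar> \<le> e / V * enorm d (\<lambda>m. y m - z t m)"
      using g unfolding has_gradient_def z_def by meson
    show "\<exists>d'>0. \<forall>s. norm (s - t) < d' \<longrightarrow>
        norm (h (z s) - h (z t) - ip d g v * (s - t)) \<le> e * norm (s - t)"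
    proof (intro exI[of _ "\<delta> / V"] conjI allI impI)
      show "\<delta> / V > 0" using \<delta> V by simp
      fix s assume s: "norm (s - t) < \<delta> / V"
      have le: "\<bar>s - t\<bar> * enorm d v \<le> \<bar>s - t\<bar> * V"
        using V by (intro mult_left_mono) auto
      have "\<bar>s - t\<bar> * V < \<delta>" using s V by (simp add: field_simps)
      with le have "enorm d (\<lambda>m. z s m - z t m) < \<delta>"
        unfolding diff enorm_scale by linarith
      from D[OF zR this] have "\<bar>h (z s) - h (z t) - (s - t) * ip d g v\<bar> \<le> e / V * (\<bar>s - t\<bar> * enorm d v)"
        unfolding diff enorm_scale ip_scale_right .
      also have "\<dots> \<le> e / V * (\<bar>s - t\<bar> * V)"
        using le e V by (intro mult_left_mono) auto
      also have "\<dots> = e * \<bar>s - t\<bar>" using V by simp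
      finally show "norm (h (z s) - h (z t) - ip d g v * (s - t)) \<le> e * norm (s - t)"
        by (simp add: mult.commute)
    qed
  qed
  then show ?thesis unfolding has_field_derivative_def z_def .
qed

lemma has_gradient_unique:
  assumes "has_gradient d h g x" "has_gradient d h g' x" and x: "x \<in> Rd d"
  shows "g = g'"
proof
  fix m
  show "g m = g' m"
  proof (cases "m < d")
    case True
    define v where "v = (\<lambda>k. if k = m then 1 else 0::real)"
    have v: "v \<in> Rd d" using True by (auto simp: v_def Rd_def)
    have "ip d a v = a m" for a
      using True by (simp add: ip_def v_def if_distrib[of "(*) _"] cong: if_cong)
    moreover have "ip d g v = ip d g' v"
      using has_gradient_line[of d h g x 0 v] has_gradient_line[of d h g' x 0 v] assms v
      by (intro DERIV_unique[of "\<lambda>s. h (\<lambda>m. x m + s * v m)" _ 0]) auto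
    ultimately show ?thesis by simp
  next
    case False
    then show ?thesis using assms by (auto simp: has_gradient_def Rd_def)
  qed
qed

lemma grad_eqI: "has_gradient d h g x \<Longrightarrow> x \<in> Rd d \<Longrightarrow> grad d h x = g"
  unfolding grad_def using has_gradient_unique by blast

lemma has_gradient_grad: "differentiable_at d h x \<Longrightarrow> x \<in> Rd d \<Longrightarrow> has_gradient d h (grad d h x) x"
  unfolding differentiable_at_def using grad_eqI by metis

lemma has_gradient_add:
  assumes "has_gradient d h1 g1 x" "has_gradient d h2 g2 x"
  shows "has_gradient d (\<lambda>y. h1 y + h2 y) (\<lambda>m. g1 m + g2 m) x"
  unfolding has_gradient_def
proof (intro conjI allI impI)
  show "(\<lambda>m. g1 m + g2 m) \<in> Rd d" using assms by (simp add: has_gradient_def Rd_def)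
  fix e :: real assume "e > 0"
  then have e2: "e / 2 > 0" by simp
  obtain \<delta>1 where 1: "\<delta>1 > 0" "\<And>y. y \<in> Rd d \<Longrightarrow> enorm d (\<lambda>m. y m - x m) < \<delta>1 \<Longrightarrow>
        \<bar>h1 y - h1 x - ip d g1 (\<lambda>m. y m - x m)\<bar> \<le> e / 2 * enorm d (\<lambda>m. y m - x m)"
    using assms(1) e2 unfolding has_gradient_def by meson
  obtain \<delta>2 where 2: "\<delta>2 > 0" "\<And>y. y \<in> Rd d \<Longrightarrow> enorm d (\<lambda>m. y m - x m) < \<delta>2 \<Longrightarrow>
        \<bar>h2 y - h2 x - ip d g2 (\<lambda>m. y m - x m)\<bar> \<le> e / 2 * enorm d (\<lambda>m. y m - x m)"
    using assms(2) e2 unfolding has_gradient_def by meson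
  show "\<exists>\<delta>>0. \<forall>y\<in>Rd d. enorm d (\<lambda>m. y m - x m) < \<delta> \<longrightarrow>
      \<bar>h1 y + h2 y - (h1 x + h2 x) - ip d (\<lambda>m. g1 m + g2 m) (\<lambda>m. y m - x m)\<bar>
      \<le> e * enorm d (\<lambda>m. y m - x m)"
  proof (intro exI[of _ "min \<delta>1 \<delta>2"] conjI ballI impI)
    fix y assume y: "y \<in> Rd d" "enorm d (\<lambda>m. y m - x m) < min \<delta>1 \<delta>2"
    have "ip d (\<lambda>m. g1 m + g2 m) (\<lambda>m. y m - x m)
        = ip d g1 (\<lambda>m. y m - x m) + ip d g2 (\<lambda>m. y m - x m)"
      by (simp add: ip_def algebra_simps flip: sum.distrib)
    moreover have "\<bar>h1 y - h1 x - ip d g1 (\<lambda>m. y m - x m)\<bar> \<le> e * enorm d (\<lambda>m. y m - x m) / 2"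
      "\<bar>h2 y - h2 x - ip d g2 (\<lambda>m. y m - x m)\<bar> \<le> e * enorm d (\<lambda>m. y m - x m) / 2"
      using 1(2)[OF y(1)] 2(2)[OF y(1)] y(2) by simp_all
    ultimately show "\<bar>h1 y + h2 y - (h1 x + h2 x) - ip d (\<lambda>m. g1 m + g2 m) (\<lambda>m. y m - x m)\<bar>
        \<le> e * enorm d (\<lambda>m. y m - x m)"
      by linarith
  qed (use 1 2 in auto)
qed

lemma has_gradient_scale:
  assumes "has_gradient d h g x"
  shows "has_gradient d (\<lambda>y. c * h y) (\<lambda>m. c * g m) x"
  unfolding has_gradient_def
proof (intro conjI allI impI)
  show "(\<lambda>m. c * g m) \<in> Rd d" using assms by (simp add: has_gradient_def Rd_def)
  fix e :: real assume e: "e > 0"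
  then have "e / (1 + \<bar>c\<bar>) > 0" by simp
  then obtain \<delta> where \<delta>: "\<delta> > 0" and D: "\<And>y. y \<in> Rd d \<Longrightarrow> enorm d (\<lambda>m. y m - x m) < \<delta> \<Longrightarrow>
        \<bar>h y - h x - ip d g (\<lambda>m. y m - x m)\<bar> \<le> e / (1 + \<bar>c\<bar>) * enorm d (\<lambda>m. y m - x m)"
    using assms(1) unfolding has_gradient_def by meson
  show "\<exists>\<delta>>0. \<forall>y\<in>Rd d. enorm d (\<lambda>m. y m - x m) < \<delta> \<longrightarrow>
      \<bar>c * h y - c * h x - ip d (\<lambda>m. c * g m) (\<lambda>m. y m - x m)\<bar> \<le> e * enorm d (\<lambda>m. y m - x m)"
  proof (intro exI[of _ \<delta>] conjI ballI impI)
    fix y assume y: "y \<in> Rd d" "enorm d (\<lambda>m. y m - x m) < \<delta>"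
    have "ip d (\<lambda>m. c * g m) (\<lambda>m. y m - x m) = c * ip d g (\<lambda>m. y m - x m)"
      by (simp add: ip_def sum_distrib_left mult_ac)
    then have "\<bar>c * h y - c * h x - ip d (\<lambda>m. c * g m) (\<lambda>m. y m - x m)\<bar>
        = \<bar>c\<bar> * \<bar>h y - h x - ip d g (\<lambda>m. y m - x m)\<bar>"
      by (simp flip: abs_mult add: algebra_simps)
    also have "\<dots> \<le> \<bar>c\<bar> * (e / (1 + \<bar>c\<bar>) * enorm d (\<lambda>m. y m - x m))"
      using D[OF y] by (intro mult_left_mono) auto
    also have "\<dots> = (\<bar>c\<bar> / (1 + \<bar>c\<bar>)) * (e * enorm d (\<lambda>m. y m - x m))" by simp
    also have "\<dots> \<le> 1 * (e * enorm d (\<lambda>m. y m - x m))"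
      using e by (intro mult_right_mono) auto
    finally show "\<bar>c * h y - c * h x - ip d (\<lambda>m. c * g m) (\<lambda>m. y m - x m)\<bar>
        \<le> e * enorm d (\<lambda>m. y m - x m)" by simp
  qed (rule \<delta>)
qed

lemma has_gradient_sum:
  assumes "finite I" "\<And>i. i \<in> I \<Longrightarrow> has_gradient d (h i) (g i) x"
  shows "has_gradient d (\<lambda>y. \<Sum>i\<in>I. h i y) (\<lambda>m. \<Sum>i\<in>I. g i m) x"
  using assms
proof (induction I)
  case empty
  show ?case by (auto simp: has_gradient_def Rd_def ip_def intro: exI[of _ 1])
next
  case (insert i I)
  then show ?case using has_gradient_add[of d "h i" "g i" x] by simp
qed

text \<open>
  Along the segment from \<open>x\<close> to \<open>x + v\<close>, the function minus its claimed quadratic upper bound has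
  a nonpositive derivative by Cauchy-Schwarz and the Lipschitz condition.
\<close>

lemma descent_lemma:
  assumes grad: "\<And>z. z \<in> Rd d \<Longrightarrow> has_gradient d h (G z) z"
    and lip: "\<And>z z'. z \<in> Rd d \<Longrightarrow> z' \<in> Rd d \<Longrightarrow>
      enorm d (\<lambda>m. G z m - G z' m) \<le> L * enorm d (\<lambda>m. z m - z' m)"
    and x: "x \<in> Rd d" and v: "v \<in> Rd d"
  shows "h (\<lambda>m. x m + v m) \<le> h x + ip d (G x) v + L / 2 * sqn d v"
proof -
  define z where "z = (\<lambda>s::real. (\<lambda>m. x m + s * v m))"
  have zR: "z s \<in> Rd d" for s using x v by (simp add: z_def Rd_def)
  define \<psi> where "\<psi> = (\<lambda>s. h (z s) - s * ip d (G x) v - L / 2 * s\<^sup>2 * sqn d v)"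
  have "\<psi> 0 \<ge> \<psi> 1"
  proof (rule DERIV_nonpos_imp_nonincreasing[of 0 1])
    fix s :: real assume s: "0 \<le> s" "s \<le> 1"
    have "((\<lambda>s. h (z s)) has_real_derivative ip d (G (z s)) v) (at s)"
      unfolding z_def by (rule has_gradient_line) (use grad[OF zR] x v in \<open>auto simp: z_def\<close>)
    then have "(\<psi> has_real_derivative ip d (G (z s)) v - ip d (G x) v - L * s * sqn d v) (at s)"
      unfolding \<psi>_def by (auto intro!: derivative_eq_intros)
    moreover have "ip d (G (z s)) v - ip d (G x) v - L * s * sqn d v \<le> 0"
    proof -
      have "ip d (G (z s)) v - ip d (G x) v = ip d (\<lambda>m. G (z s) m - G x m) v"
        by (simp add: ip_def sum_subtractf algebra_simps)
      also have "\<dots> \<le> enorm d (\<lambda>m. G (z s) m - G x m) * enorm d v" by (rule ip_le_enorm)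
      also have "\<dots> \<le> (L * enorm d (\<lambda>m. z s m - x m)) * enorm d v"
        using lip[OF zR x] by (intro mult_right_mono) auto
      also have "(\<lambda>m. z s m - x m) = (\<lambda>m. s * v m)" by (simp add: z_def)
      also have "(L * enorm d (\<lambda>m. s * v m)) * enorm d v = L * s * (enorm d v)\<^sup>2"
        using s by (simp add: enorm_scale power2_eq_square)
      finally show ?thesis by (simp add: enorm_sq)
    qed
    ultimately show "\<exists>y. (\<psi> has_real_derivative y) (at s) \<and> y \<le> 0" by blast
  qed simp
  then show ?thesis by (simp add: \<psi>_def z_def)
qed

section \<open>Sampling without replacement\<close>

lemma card_subsets_containing:
  assumes "finite A" "S \<subseteq> A" "card S \<le> b"
  shows "card {I. I \<subseteq> A \<and> card I = b \<and> S \<subseteq> I} = (card A - card S) choose (b - card S)"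
proof -
  have fS: "finite S" using assms finite_subset by blast
  have "bij_betw (\<lambda>I. I - S) {I. I \<subseteq> A \<and> card I = b \<and> S \<subseteq> I} {J. J \<subseteq> A - S \<and> card J = b - card S}"
  proof (rule bij_betw_byWitness[where f' = "\<lambda>J. J \<union> S"])
    show "(\<lambda>I. I - S) ` {I. I \<subseteq> A \<and> card I = b \<and> S \<subseteq> I} \<subseteq> {J. J \<subseteq> A - S \<and> card J = b - card S}"
      using fS by (auto simp: card_Diff_subset)
    show "(\<lambda>J. J \<union> S) ` {J. J \<subseteq> A - S \<and> card J = b - card S} \<subseteq> {I. I \<subseteq> A \<and> card I = b \<and> S \<subseteq> I}"
    proof clarify
      fix J assume J: "J \<subseteq> A - S" "card J = b - card S"
      then have "finite J" "J \<inter> S = {}" using assms(1) finite_subset by blast+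
      then have "card (J \<union> S) = b" using J fS assms(3) by (simp add: card_Un_disjoint)
      then show "J \<union> S \<subseteq> A \<and> card (J \<union> S) = b \<and> S \<subseteq> J \<union> S" using J assms by auto
    qed
  qed auto
  then have "card {I. I \<subseteq> A \<and> card I = b \<and> S \<subseteq> I} = card {J. J \<subseteq> A - S \<and> card J = b - card S}"
    by (rule bij_betw_same_card)
  also have "\<dots> = (card A - card S) choose (b - card S)"
    using assms fS by (simp add: n_subsets card_Diff_subset)
  finally show ?thesis .
qed

text \<open>
  Expanding the square, the pair \<open>(i, k)\<close> is counted by the number of \<open>b\<close>-subsets that contain both
  elements. This number takes one value \<open>P\<close> on the diagonal and another value \<open>Q \<ge> 0\<close> off it;
  because the \<open>a i\<close> sum to zero, the off-diagonal terms add up to \<open>- Q\<close> times the sum of squares.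
\<close>

lemma sum_squares_over_subsets:
  fixes a :: "'a \<Rightarrow> real"
  assumes A: "finite A" and b: "1 \<le> b" and zero: "sum a A = 0"
  defines "K \<equiv> {I. I \<subseteq> A \<and> card I = b}"
  shows "(\<Sum>I\<in>K. (sum a I)\<^sup>2) \<le> real ((card A - 1) choose (b - 1)) * (\<Sum>i\<in>A. (a i)\<^sup>2)"
proof -
  define P where "P = real ((card A - 1) choose (b - 1))"
  define Q where "Q = (if b \<ge> 2 then real ((card A - 2) choose (b - 2)) else 0)"
  have finK: "finite K" using A by (simp add: K_def)
  have N: "real (card {I\<in>K. i \<in> I \<and> k \<in> I}) = (if i = k then P else Q)" if "i \<in> A" "k \<in> A" for i k
  proof -
    have eq: "{I\<in>K. i \<in> I \<and> k \<in> I} = {I. I \<subseteq> A \<and> card I = b \<and> {i, k} \<subseteq> I}"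
      by (auto simp: K_def)
    show ?thesis
    proof (cases "i = k")
      case True
      then show ?thesis using card_subsets_containing[of A "{i,k}" b] A b that
        unfolding eq by (simp add: P_def)
    next
      case False
      show ?thesis
      proof (cases "b \<ge> 2")
        case True
        then show ?thesis using card_subsets_containing[of A "{i,k}" b] A that False
          unfolding eq by (simp add: Q_def numeral_2_eq_2)
      next
        case b2: False
        have "card I \<noteq> b" if "I \<subseteq> A" "{i, k} \<subseteq> I" for I
        proof -
          have "card {i, k} \<le> card I" using that A finite_subset by (intro card_mono) auto
          with False b2 show ?thesis by simp
        qed
        then have none: "{I. I \<subseteq> A \<and> card I = b \<and> {i, k} \<subseteq> I} = {}" by blast
        show ?thesis unfolding eq none using False b2 by (simp add: Q_def)
      qed
    qed
  qed
  have "(sum a I)\<^sup>2 = (\<Sum>i\<in>A. \<Sum>k\<in>A. if i \<in> I \<and> k \<in> I then a i * a k else 0)" if "I \<in> K" for I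
  proof -
    have sub: "I \<subseteq> A" using that by (simp add: K_def)
    have *: "sum a I = (\<Sum>i\<in>A. if i \<in> I then a i else 0)"
      using sub A by (simp add: sum.If_cases Int_absorb1)
    show ?thesis
      unfolding * power2_eq_square sum_product by (intro sum.cong refl) auto
  qed
  then have "(\<Sum>I\<in>K. (sum a I)\<^sup>2)
      = (\<Sum>I\<in>K. \<Sum>i\<in>A. \<Sum>k\<in>A. if i \<in> I \<and> k \<in> I then a i * a k else 0)"
    by (rule sum.cong[OF refl])
  also have "\<dots> = (\<Sum>i\<in>A. \<Sum>I\<in>K. \<Sum>k\<in>A. if i \<in> I \<and> k \<in> I then a i * a k else 0)"
    by (rule sum.swap)
  also have "\<dots> = (\<Sum>i\<in>A. \<Sum>k\<in>A. \<Sum>I\<in>K. if i \<in> I \<and> k \<in> I then a i * a k else 0)"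
    by (intro sum.cong refl sum.swap)
  also have "\<dots> = (\<Sum>i\<in>A. \<Sum>k\<in>A. a i * a k * (if i = k then P else Q))"
  proof (intro sum.cong refl)
    fix i k assume ik: "i \<in> A" "k \<in> A"
    have "(\<Sum>I\<in>K. if i \<in> I \<and> k \<in> I then a i * a k else 0)
        = real (card {I\<in>K. i \<in> I \<and> k \<in> I}) * (a i * a k)"
      using finK by (simp add: sum.If_cases Int_def)
    then show "(\<Sum>I\<in>K. if i \<in> I \<and> k \<in> I then a i * a k else 0) = a i * a k * (if i = k then P else Q)"
      unfolding N[OF ik] by simp
  qed
  also have "\<dots> = (\<Sum>i\<in>A. (P - Q) * (a i)\<^sup>2)"
  proof (intro sum.cong refl)
    fix i assume i: "i \<in> A"
    have "(\<Sum>k\<in>A. a i * a k * (if i = k then P else Q))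
        = (\<Sum>k\<in>A. Q * a i * a k + (if i = k then (P - Q) * (a i)\<^sup>2 else 0))"
      by (intro sum.cong refl) (auto simp: algebra_simps power2_eq_square)
    also have "\<dots> = Q * a i * sum a A + (P - Q) * (a i)\<^sup>2"
      using A i by (simp add: sum.distrib sum_distrib_left)
    finally show "(\<Sum>k\<in>A. a i * a k * (if i = k then P else Q)) = (P - Q) * (a i)\<^sup>2"
      using zero by simp
  qed
  also have "\<dots> \<le> (\<Sum>i\<in>A. P * (a i)\<^sup>2)"
    by (intro sum_mono mult_right_mono) (auto simp: Q_def)
  finally show ?thesis by (simp add: sum_distrib_left P_def)
qed

text \<open>
  Different elements of a sample without replacement are negatively correlated, so the second
  moment of a centred batch mean is at most what it would be under sampling with replacement.
\<close>

lemma batch_mean_square_le: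
  fixes a :: "'a \<Rightarrow> real"
  assumes A: "finite A" and b: "1 \<le> b" "b \<le> card A" and zero: "sum a A = 0"
  defines "K \<equiv> {I. I \<subseteq> A \<and> card I = b}"
  shows "(\<Sum>I\<in>K. (sum a I / real b)\<^sup>2) / real (card K) \<le> (\<Sum>i\<in>A. (a i)\<^sup>2) / real (card A) / real b"
proof -
  have cK: "card K = card A choose b" unfolding K_def by (rule n_subsets[OF A])
  then have Kpos: "real (card K) > 0" using b by simp
  have npos: "real (card A) > 0" and bpos: "real b > 0" using b by auto
  have "card A * ((card A - 1) choose (b - 1)) = b * card K"
    unfolding cK using times_binomial_minus1_eq[of b "card A"] b by simp
  then have e: "real ((card A - 1) choose (b - 1)) = real b * real (card K) / real (card A)"
    using npos by (simp add: field_simps flip: of_nat_mult)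
  have "(\<Sum>I\<in>K. (sum a I / real b)\<^sup>2) = (\<Sum>I\<in>K. (sum a I)\<^sup>2) / (real b)\<^sup>2"
    by (simp add: power_divide flip: sum_divide_distrib)
  also have "\<dots> \<le> (real b * real (card K) / real (card A) * (\<Sum>i\<in>A. (a i)\<^sup>2)) / (real b)\<^sup>2"
    using sum_squares_over_subsets[OF A b(1) zero] unfolding e K_def[symmetric]
    by (rule divide_right_mono) simp
  also have "\<dots> = real (card K) * ((\<Sum>i\<in>A. (a i)\<^sup>2) / real (card A) / real b)"
    using bpos by (simp add: power2_eq_square)
  finally show ?thesis using Kpos by (simp add: field_simps)
qed

lemma nn_integral_uniform_subset:
  assumes "b \<le> n" and F: "\<And>I. I \<subseteq> {1..n} \<Longrightarrow> 0 \<le> F I"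
  shows "(\<integral>\<^sup>+I. ennreal (F I) \<partial>measure_pmf (uniform_subset n b))
       = ennreal ((\<Sum>I | I \<subseteq> {1..n} \<and> card I = b. F I) / real (card {I. I \<subseteq> {1..n} \<and> card I = b}))"
proof -
  define K where "K = {I. I \<subseteq> {1..n} \<and> card I = b}"
  have cK: "card K = n choose b" unfolding K_def by (subst n_subsets) auto
  then have "card K > 0" using assms(1) by simp
  then have K: "finite K" "K \<noteq> {}" and K0: "real (card K) > 0" by (auto simp: card_gt_0_iff)
  have "(\<integral>\<^sup>+I. ennreal (F I) \<partial>measure_pmf (uniform_subset n b)) = (\<Sum>I\<in>K. ennreal (F I)) / of_nat (card K)"
    unfolding uniform_subset_def K_def[symmetric] by (rule nn_integral_pmf_of_set[OF K(2,1)])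
  also have "\<dots> = ennreal (\<Sum>I\<in>K. F I) / ennreal (real (card K))"
    using F by (subst sum_ennreal) (auto simp: K_def ennreal_of_nat_eq_real_of_nat)
  also have "\<dots> = ennreal ((\<Sum>I\<in>K. F I) / real (card K))"
    using F K0 by (intro divide_ennreal sum_nonneg) (auto simp: K_def)
  finally show ?thesis unfolding K_def .
qed

lemma set_uniform_subset:
  assumes "b \<le> n"
  shows "set_pmf (uniform_subset n b) = {I. I \<subseteq> {1..n} \<and> card I = b}"
proof -
  have "card {1..b} = b" "{1..b} \<subseteq> {1..n}" using assms by auto
  then have "{I. I \<subseteq> {1..n} \<and> card I = b} \<noteq> {}" by blast
  then show ?thesis unfolding uniform_subset_def by (intro set_pmf_of_set) auto
qed

lemma nn_integral_uniform_singleton: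
  assumes "1 \<le> n" and F: "\<And>i. i \<in> {1..n} \<Longrightarrow> 0 \<le> F {i}"
  shows "(\<integral>\<^sup>+I. ennreal (F I) \<partial>measure_pmf (uniform_subset n 1))
       = ennreal ((\<Sum>i=1..n. F {i}) / real n)"
proof -
  have eq: "{I. I \<subseteq> {1..n} \<and> card I = 1} = (\<lambda>i. {i}) ` {1..n}"
    by (auto simp: card_1_singleton_iff)
  have "(\<integral>\<^sup>+I. ennreal (F I) \<partial>measure_pmf (uniform_subset n 1))
      = (\<integral>\<^sup>+I. ennreal (if card I = 1 then F I else 0) \<partial>measure_pmf (uniform_subset n 1))"
    by (rule nn_integral_cong_AE) (simp add: AE_measure_pmf_iff set_uniform_subset[OF assms(1)] del: One_nat_def)
  also have "\<dots> = ennreal ((\<Sum>I | I \<subseteq> {1..n} \<and> card I = 1. (if card I = 1 then F I else 0))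
      / real (card {I. I \<subseteq> {1..n} \<and> card I = 1}))"
    using F assms(1) by (intro nn_integral_uniform_subset) (auto simp: card_1_singleton_iff)
  also have "\<dots> = ennreal ((\<Sum>i=1..n. F {i}) / real n)"
    unfolding eq by (simp add: sum.reindex card_image)
  finally show ?thesis .
qed

section \<open>Geometric stopping, output weights and cost\<close>

text \<open>
  Discounted telescoping. The factor \<open>1 + 1/B\<close> is the inverse of the probability \<open>B / (B + 1)\<close> that
  the geometric variable survives one more step, so \<open>(1 + 1/B) P(N = k) a k\<close> telescopes along the
  hypothesis. Only the initial term remains, with the weight \<open>(1 + 1/B) P(N = 0) = 1/B\<close>. The
  discounted final term is simply dropped, so \<open>a\<close> may grow at any rate compatible with the
  hypothesis and may even be infinite.
\<close>

lemma nn_integral_geometric_le: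
  fixes a q :: "nat \<Rightarrow> ennreal" and h :: ennreal and B :: real
  assumes B: "B > 0" and step: "\<And>k. a (Suc k) + q k \<le> ennreal (1 + 1 / B) * a k + h"
  shows "(\<integral>\<^sup>+k. q k \<partial>measure_pmf (geometric_pmf (1 / (B + 1)))) \<le> ennreal (1 / B) * a 0 + h"
proof -
  define M where "M = geometric_pmf (1 / (B + 1))"
  define r where "r = (\<lambda>k. ennreal (pmf M k))"
  define s where "s = (\<lambda>k. ennreal (1 + 1 / B) * r k)"
  have p: "pmf M k = (B / (B + 1)) ^ k * (1 / (B + 1))" for k
  proof -
    have "1 - 1 / (B + 1) = B / (B + 1)" using B by (simp add: field_simps)
    then show ?thesis using B unfolding M_def by (subst pmf_geometric) auto
  qed
  have s0: "s 0 = ennreal (1 / B)"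
  proof -
    have "(1 + 1 / B) * (1 / (B + 1)) = 1 / B" using B by (simp add: divide_simps)
    then show ?thesis unfolding s_def r_def p using B
      by (simp del: ennreal_plus flip: ennreal_mult)
  qed
  have sSuc: "s (Suc k) = r k" for k
  proof -
    have "1 + 1 / B = (B + 1) / B" using B by (simp add: field_simps)
    then have "(1 + 1 / B) * (B / (B + 1)) = 1" using B by simp
    then have "(1 + 1 / B) * pmf M (Suc k) = pmf M k" unfolding p power_Suc
      by (metis mult.assoc mult_1)
    then show ?thesis unfolding s_def r_def using B by (simp del: ennreal_plus flip: ennreal_mult)
  qed
  have main: "s K * a K + (\<Sum>k<K. r k * q k) \<le> s 0 * a 0 + (\<Sum>k<K. r k) * h" for K
  proof (induction K)
    case (Suc K)
    have "s (Suc K) * a (Suc K) + (\<Sum>k<Suc K. r k * q k)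
        = r K * (a (Suc K) + q K) + (\<Sum>k<K. r k * q k)"
      by (simp add: sSuc algebra_simps)
    also have "\<dots> \<le> r K * (ennreal (1 + 1 / B) * a K + h) + (\<Sum>k<K. r k * q k)"
      using step by (intro add_right_mono mult_left_mono) auto
    also have "\<dots> = (s K * a K + (\<Sum>k<K. r k * q k)) + r K * h"
      by (simp add: s_def algebra_simps)
    also have "\<dots> \<le> (s 0 * a 0 + (\<Sum>k<K. r k) * h) + r K * h"
      by (rule add_right_mono) (rule Suc.IH)
    also have "\<dots> = s 0 * a 0 + (\<Sum>k<Suc K. r k) * h"
      by (simp add: algebra_simps)
    finally show ?case .
  qed simp
  have le1: "(\<Sum>k<K. r k) \<le> 1" for K
  proof -
    have "(\<Sum>k<K. q ^ k * (1 - q)) = 1 - q ^ K" for q :: real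
      by (induction K) (simp_all add: algebra_simps)
    moreover have "1 - B / (B + 1) = 1 / (B + 1)" using B by (simp add: field_simps)
    ultimately have "(\<Sum>k<K. pmf M k) = 1 - (B / (B + 1)) ^ K" unfolding p by metis
    also have "\<dots> \<le> 1" using B by simp
    finally have "ennreal (\<Sum>k<K. pmf M k) \<le> 1" by simp
    moreover have "(\<Sum>k<K. r k) = ennreal (\<Sum>k<K. pmf M k)" unfolding r_def by (rule sum_ennreal) simp
    ultimately show ?thesis by simp
  qed
  have "(\<integral>\<^sup>+k. q k \<partial>measure_pmf M) = (\<Sum>k. r k * q k)"
    unfolding nn_integral_measure_pmf r_def by (rule nn_integral_count_space_nat)
  also have "\<dots> \<le> s 0 * a 0 + h"
  proof (rule suminf_le_const)
    fix K
    have "(\<Sum>k<K. r k * q k) \<le> s K * a K + (\<Sum>k<K. r k * q k)" by simp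
    also have "\<dots> \<le> s 0 * a 0 + (\<Sum>k<K. r k) * h" by (rule main)
    also have "\<dots> \<le> s 0 * a 0 + 1 * h" using le1 by (intro add_left_mono mult_right_mono) auto
    finally show "(\<Sum>k<K. r k * q k) \<le> s 0 * a 0 + h" by simp
  qed simp
  finally show ?thesis unfolding s0 M_def .
qed

text \<open>
  For the linear potential \<open>a k = B * k\<close>, the hypothesis of the telescoping is an equation with
  \<open>h = B\<close>.
\<close>

lemma nn_integral_geometric_of_nat_le:
  assumes "B > 0"
  shows "(\<integral>\<^sup>+N. of_nat N \<partial>measure_pmf (geometric_pmf (1 / (B + 1)))) \<le> ennreal B"
proof -
  have "(\<integral>\<^sup>+N. of_nat N \<partial>measure_pmf (geometric_pmf (1 / (B + 1))))
      \<le> ennreal (1 / B) * ennreal (B * real 0) + ennreal B"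
  proof (rule nn_integral_geometric_le[OF assms, of "\<lambda>k. ennreal (B * real k)"])
    fix k
    have "B * real (Suc k) + real k = (1 + 1 / B) * (B * real k) + B"
      using assms by (simp add: field_simps)
    moreover have "of_nat k = ennreal (real k)" by (simp add: ennreal_of_nat_eq_real_of_nat)
    ultimately show "ennreal (B * real (Suc k)) + of_nat k
        \<le> ennreal (1 + 1 / B) * ennreal (B * real k) + ennreal B"
      using assms by (simp del: of_nat_Suc ennreal_plus flip: ennreal_plus ennreal_mult)
  qed
  then show ?thesis by simp
qed

lemma batch_size_bounds: "n \<ge> 1 \<Longrightarrow> j \<ge> 1 \<Longrightarrow> 1 \<le> batch_size n j \<and> batch_size n j \<le> n"
proof -
  assume n: "n \<ge> 1" and j: "j \<ge> 1"
  then have "real j powr (3/2) > 0" by simp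
  then have "\<lceil>real j powr (3/2)\<rceil> \<ge> 1" by linarith
  then have "nat \<lceil>real j powr (3/2)\<rceil> \<ge> 1" by linarith
  with n show ?thesis by (simp add: batch_size_def)
qed

lemma batch_size_ge: "batch_size n j < n \<Longrightarrow> real j powr (3/2) \<le> real (batch_size n j)"
proof -
  assume "batch_size n j < n"
  then have "batch_size n j = nat \<lceil>real j powr (3/2)\<rceil>" by (simp add: batch_size_def split: if_splits)
  then show ?thesis by (simp add: of_nat_ceiling)
qed

lemma nn_integral_output_index:
  assumes T: "T \<ge> 1" and pos: "\<And>j. j \<in> {1..T} \<Longrightarrow> \<eta> j * real (B j) / real (b j) > 0"
    and F: "\<And>j. j \<in> {1..T} \<Longrightarrow> 0 \<le> F j"
  shows "(\<integral>\<^sup>+j. ennreal (F j) \<partial>measure_pmf (output_index \<eta> B b T))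
       = ennreal ((\<Sum>j=1..T. \<eta> j * real (B j) / real (b j) * F j) / (\<Sum>j=1..T. \<eta> j * real (B j) / real (b j)))"
proof -
  define w where "w = (\<lambda>j. \<eta> j * real (B j) / real (b j))"
  define W where "W = sum w {1..T}"
  define p where "p = (\<lambda>j. if j \<in> {1..T} then w j / W else 0)"
  have w: "w j > 0" if "j \<in> {1..T}" for j using pos[OF that] by (simp add: w_def)
  have W: "W > 0" unfolding W_def using T w by (intro sum_pos) auto
  have p0: "p j \<ge> 0" for j using w[of j] W by (auto simp: p_def)
  have "(\<integral>\<^sup>+j. ennreal (p j) \<partial>count_space UNIV) = (\<integral>\<^sup>+j. ennreal (w j / W) \<partial>count_space {1..T})"
    by (subst (2) nn_integral_count_space_indicator)
      (auto simp: p_def indicator_def intro!: nn_integral_cong)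
  also have "\<dots> = (\<Sum>j=1..T. ennreal (w j / W))"
    by (rule nn_integral_count_space_finite) simp
  also have "\<dots> = ennreal (\<Sum>j=1..T. w j / W)"
    using w W by (intro sum_ennreal) (simp add: less_imp_le)
  also have "(\<Sum>j=1..T. w j / W) = 1" using W by (simp add: W_def flip: sum_divide_distrib)
  finally have p1: "(\<integral>\<^sup>+j. ennreal (p j) \<partial>count_space UNIV) = 1" by simp
  have oi: "output_index \<eta> B b T = embed_pmf p"
    unfolding output_index_def p_def W_def w_def ..
  have pmf: "pmf (output_index \<eta> B b T) j = p j" for j
    unfolding oi by (rule pmf_embed_pmf) (use p0 p1 in auto)
  have set: "set_pmf (output_index \<eta> B b T) \<subseteq> {1..T}"
    by (auto simp: set_pmf_iff pmf p_def split: if_splits)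
  have "(\<integral>\<^sup>+j. ennreal (F j) \<partial>measure_pmf (output_index \<eta> B b T))
      = (\<Sum>j=1..T. ennreal (F j) * ennreal (p j))"
    using set unfolding pmf[symmetric]
    by (intro nn_integral_measure_pmf_support) auto
  also have "\<dots> = (\<Sum>j=1..T. ennreal (w j * F j / W))"
    using F w W by (intro sum.cong) (auto simp: p_def mult.commute less_imp_le simp flip: ennreal_mult)
  also have "\<dots> = ennreal (\<Sum>j=1..T. w j * F j / W)"
    using F w W by (intro sum_ennreal) (simp add: less_imp_le)
  finally show ?thesis unfolding sum_divide_distrib[symmetric] w_def W_def .
qed

text \<open>
  The number of inner steps is drawn independently of the iterates and has mean at most \<open>B j\<close>,
  which at most doubles the cost of the large batch.
\<close>

lemma expected_total_cost_le:
  assumes B: "\<And>j. j \<ge> 1 \<Longrightarrow> B j \<ge> 1"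
  shows "(\<integral>\<^sup>+\<omega>. of_nat (total_cost B minibatch_size T \<omega>)
            \<partial>measure_pmf (scsg_run d n f \<eta> B minibatch_size x0 T)) \<le> ennreal (\<Sum>j=1..T. 2 * real (B j))"
proof (induction T)
  case 0
  show ?case by (simp add: total_cost_def)
next
  case (Suc T)
  have B1: "B (Suc T) \<ge> 1" using B by simp
  have epoch: "(\<integral>\<^sup>+p. of_nat (snd p) \<partial>measure_pmf (scsg_epoch d n f s (B (Suc T)) (minibatch_size (Suc T)) x))
      \<le> ennreal (real (B (Suc T)))" for s x
  proof -
    have "1 - real (B (Suc T)) / (real (B (Suc T)) + 1) = 1 / (real (B (Suc T)) + 1)"
      by (simp add: field_simps)
    then show ?thesis
      using nn_integral_geometric_of_nat_le[of "real (B (Suc T))"] B1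
      by (simp add: scsg_epoch_def minibatch_size_def)
  qed
  have split: "(of_nat (total_cost B minibatch_size (Suc T) (fun_upd \<omega> (Suc T) p)) :: ennreal)
      = of_nat (total_cost B minibatch_size T \<omega>) + (of_nat (B (Suc T)) + of_nat (snd p))" for \<omega> p
  proof -
    have "total_cost B minibatch_size T (fun_upd \<omega> (Suc T) p) = total_cost B minibatch_size T \<omega>"
      unfolding total_cost_def by (intro sum.cong) auto
    then have "total_cost B minibatch_size (Suc T) (fun_upd \<omega> (Suc T) p)
        = total_cost B minibatch_size T \<omega> + (B (Suc T) + snd p)"
      by (simp add: total_cost_def minibatch_size_def)
    then show ?thesis by simp
  qed
  have "(\<integral>\<^sup>+\<omega>. of_nat (total_cost B minibatch_size (Suc T) \<omega>)
            \<partial>measure_pmf (scsg_run d n f \<eta> B minibatch_size x0 (Suc T)))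
      = (\<integral>\<^sup>+\<omega>. of_nat (total_cost B minibatch_size T \<omega>) + (of_nat (B (Suc T)) +
            (\<integral>\<^sup>+p. of_nat (snd p) \<partial>measure_pmf (scsg_epoch d n f (\<eta> (Suc T)) (B (Suc T))
              (minibatch_size (Suc T)) (fst (\<omega> T)))))
            \<partial>measure_pmf (scsg_run d n f \<eta> B minibatch_size x0 T))"
    by (simp add: split nn_integral_add)
  also have "\<dots> \<le> (\<integral>\<^sup>+\<omega>. of_nat (total_cost B minibatch_size T \<omega>) + (of_nat (B (Suc T)) + ennreal (real (B (Suc T))))
            \<partial>measure_pmf (scsg_run d n f \<eta> B minibatch_size x0 T))"
    by (intro nn_integral_mono add_left_mono epoch)
  also have "\<dots> \<le> ennreal (\<Sum>j=1..T. 2 * real (B j)) + ennreal (2 * real (B (Suc T)))"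
  proof -
    have "(of_nat (B (Suc T)) + ennreal (real (B (Suc T))) :: ennreal) = ennreal (2 * real (B (Suc T)))"
      by (simp add: ennreal_of_nat_eq_real_of_nat flip: ennreal_plus)
    then show ?thesis
      using add_right_mono[OF Suc.IH, of "ennreal (2 * real (B (Suc T)))"] by (simp add: nn_integral_add)
  qed
  also have "\<dots> = ennreal (\<Sum>j=1..Suc T. 2 * real (B j))"
    by (simp add: sum_nonneg flip: ennreal_plus)
  finally show ?case .
qed

section \<open>Smooth finite sums and one inner step\<close>

context
  fixes d n :: nat and f :: "nat \<Rightarrow> (nat \<Rightarrow> real) \<Rightarrow> real" and L :: real
  assumes n_ge_1: "n \<ge> 1" and L_pos: "L > 0"
    and differentiable: "\<forall>i\<in>{1..n}. \<forall>x\<in>Rd d. differentiable_at d (f i) x"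
    and smooth: "\<forall>i\<in>{1..n}. \<forall>x\<in>Rd d. \<forall>y\<in>Rd d.
      enorm d (\<lambda>m. grad d (f i) x m - grad d (f i) y m) \<le> L * enorm d (\<lambda>m. x m - y m)"
    and bdd_below: "bdd_below (objective n f ` Rd d)"
    and bdd_above: "bdd_above (grad_variance d n f ` Rd d)"
begin

abbreviation G where "G i \<equiv> grad d (f i)"
abbreviation gradF where "gradF \<equiv> grad d (objective n f)"

definition gap :: "(nat \<Rightarrow> real) \<Rightarrow> real" where
  "gap x = objective n f x - (INF x\<in>Rd d. objective n f x)"

lemma gap_nonneg: "x \<in> Rd d \<Longrightarrow> 0 \<le> gap x"
  unfolding gap_def using cINF_lower[OF bdd_below] by simp

lemma Delta_f_nonneg: "x0 \<in> Rd d \<Longrightarrow> 0 \<le> Delta_f d n f x0"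
  using gap_nonneg by (simp add: gap_def Delta_f_def)

lemma has_gradient_objective:
  assumes x: "x \<in> Rd d"
  shows "has_gradient d (objective n f) (\<lambda>m. (\<Sum>i=1..n. G i x m) / real n) x"
proof -
  have "has_gradient d (\<lambda>y. \<Sum>i=1..n. f i y) (\<lambda>m. \<Sum>i=1..n. G i x m) x"
    using x differentiable by (intro has_gradient_sum has_gradient_grad) auto
  from has_gradient_scale[OF this, of "1 / real n"] show ?thesis
    by (simp add: objective_def[abs_def])
qed

lemma gradF_eq: "x \<in> Rd d \<Longrightarrow> gradF x = (\<lambda>m. (\<Sum>i=1..n. G i x m) / real n)"
  by (rule grad_eqI[OF has_gradient_objective])

lemma G_Rd: "i \<in> {1..n} \<Longrightarrow> x \<in> Rd d \<Longrightarrow> G i x \<in> Rd d"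
  using has_gradient_grad[of d "f i" x] differentiable by (simp add: has_gradient_def)

lemma smooth_sq:
  assumes "i \<in> {1..n}" "x \<in> Rd d" "y \<in> Rd d"
  shows "sqn d (\<lambda>m. G i x m - G i y m) \<le> L\<^sup>2 * sqn d (\<lambda>m. x m - y m)"
  using smooth assms L_pos enorm_le_iff_sqn[of L] by simp

lemma sqn_mean_le:
  fixes a :: "nat \<Rightarrow> nat \<Rightarrow> real"
  shows "sqn d (\<lambda>m. (\<Sum>i=1..n. a i m) / real n) \<le> (\<Sum>i=1..n. sqn d (a i)) / real n"
proof -
  have "((\<Sum>i=1..n. a i m) / real n)\<^sup>2 \<le> (\<Sum>i=1..n. (a i m)\<^sup>2) / real n" for m
  proof -
    have "(\<Sum>i=1..n. a i m)\<^sup>2 \<le> real n * (\<Sum>i=1..n. (a i m)\<^sup>2)"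
      using sum_squared_le_sum_of_squares[of "\<lambda>i. a i m" "{1..n}"] by (simp add: mult.commute)
    then show ?thesis using n_ge_1 by (simp add: field_simps power2_eq_square)
  qed
  then have "sqn d (\<lambda>m. (\<Sum>i=1..n. a i m) / real n) \<le> (\<Sum>m<d. (\<Sum>i=1..n. (a i m)\<^sup>2) / real n)"
    unfolding sqn_def by (intro sum_mono)
  also have "\<dots> = (\<Sum>i=1..n. sqn d (a i)) / real n"
    unfolding sqn_def sum_divide_distrib[symmetric] by (subst sum.swap) simp
  finally show ?thesis .
qed

lemma smooth_objective:
  assumes x: "x \<in> Rd d" and y: "y \<in> Rd d"
  shows "enorm d (\<lambda>m. gradF x m - gradF y m) \<le> L * enorm d (\<lambda>m. x m - y m)"
proof -
  have "sqn d (\<lambda>m. gradF x m - gradF y m) = sqn d (\<lambda>m. (\<Sum>i=1..n. G i x m - G i y m) / real n)"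
    unfolding gradF_eq[OF x] gradF_eq[OF y] by (simp add: sum_subtractf diff_divide_distrib)
  also have "\<dots> \<le> (\<Sum>i=1..n. sqn d (\<lambda>m. G i x m - G i y m)) / real n"
    by (rule sqn_mean_le)
  also have "\<dots> \<le> (\<Sum>i=1..n. L\<^sup>2 * sqn d (\<lambda>m. x m - y m)) / real n"
    using x y by (intro divide_right_mono sum_mono smooth_sq) auto
  also have "\<dots> = L\<^sup>2 * sqn d (\<lambda>m. x m - y m)" using n_ge_1 by simp
  finally show ?thesis using L_pos enorm_le_iff_sqn[of L] by simp
qed

lemma gap_descent:
  assumes "x \<in> Rd d" "v \<in> Rd d"
  shows "gap (\<lambda>m. x m + v m) \<le> gap x + ip d (gradF x) v + L / 2 * sqn d v"
  using descent_lemma[of d "objective n f" gradF L x v] has_gradient_objective smooth_objective assms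
  unfolding gap_def by (simp add: gradF_eq)

lemma batch_grad_Rd: "I \<subseteq> {1..n} \<Longrightarrow> x \<in> Rd d \<Longrightarrow> batch_grad d f I x \<in> Rd d"
  using G_Rd by (auto simp: batch_grad_def Rd_def subset_iff intro!: sum.neutral)

lemma batch_gradient_error:
  assumes b: "1 \<le> b" "b \<le> n" and x: "x \<in> Rd d"
  shows "(\<Sum>I | I \<subseteq> {1..n} \<and> card I = b. sqn d (\<lambda>m. batch_grad d f I x m - gradF x m))
      / real (card {I. I \<subseteq> {1..n} \<and> card I = b})
      \<le> (if b < n then H_star d n f / real b else 0)"
proof (cases "b < n")
  case False
  then have bn: "b = n" using b by simp
  have "I = {1..n}" if "I \<subseteq> {1..n}" "card I = b" for I
    using that bn by (intro card_subset_eq) auto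
  then have "{I. I \<subseteq> {1..n} \<and> card I = b} = {{1..n}}" using bn by auto
  moreover have "batch_grad d f {1..n} x = gradF x"
    using x by (simp add: gradF_eq batch_grad_def)
  ultimately show ?thesis using bn by (simp add: sqn_def)
next
  case True
  define K where "K = {I. I \<subseteq> {1..n} \<and> card I = b}"
  define a where "a = (\<lambda>m i. G i x m - gradF x m)"
  have zero: "sum (a m) {1..n} = 0" for m
    using n_ge_1 x by (simp add: a_def sum_subtractf gradF_eq)
  have eq: "batch_grad d f I x m - gradF x m = sum (a m) I / real b" if "I \<in> K" for I m
    using that b by (simp add: K_def batch_grad_def a_def sum_subtractf field_simps)
  have "(\<Sum>I\<in>K. sqn d (\<lambda>m. batch_grad d f I x m - gradF x m)) / real (card K)
      = (\<Sum>I\<in>K. \<Sum>m<d. (sum (a m) I / real b)\<^sup>2) / real (card K)"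
    unfolding sqn_def by (simp add: eq)
  also have "\<dots> = (\<Sum>m<d. (\<Sum>I\<in>K. (sum (a m) I / real b)\<^sup>2) / real (card K))"
    by (subst sum.swap) (simp add: sum_divide_distrib)
  also have "\<dots> \<le> (\<Sum>m<d. (\<Sum>i=1..n. (a m i)\<^sup>2) / real n / real b)"
    using batch_mean_square_le[of "{1..n}" b "a _"] b zero by (intro sum_mono) (simp add: K_def)
  also have "\<dots> = grad_variance d n f x / real b"
    unfolding grad_variance_def enorm_sq sqn_def a_def sum_divide_distrib[symmetric]
    by (subst sum.swap) simp
  also have "\<dots> \<le> H_star d n f / real b"
    unfolding H_star_def using bdd_above x by (intro divide_right_mono cSUP_upper) auto
  finally show ?thesis using True by (simp add: K_def)
qed

lemma H_star_nonneg: "0 \<le> H_star d n f"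
proof -
  have "(\<lambda>_. 0) \<in> Rd d" by (simp add: Rd_def)
  then have "grad_variance d n f (\<lambda>_. 0) \<le> H_star d n f"
    unfolding H_star_def using bdd_above by (intro cSUP_upper)
  moreover have "0 \<le> grad_variance d n f (\<lambda>_. 0)"
    by (simp add: grad_variance_def sum_nonneg)
  ultimately show ?thesis by simp
qed

text \<open>
  On average over the sampled index, the potential \<open>gap x + c * |x - x0|\<^sup>2\<close> decreases in one inner step
  by \<open>\<eta> / 2 * |gradF x|\<^sup>2\<close>, up to the error of \<open>g\<close> and up to the growth by the factor \<open>1 + 1 / u\<^sup>3\<close> that geometric stopping allows. That
  growth is claimed on the right-hand side only for the drift; for the gap it reappears as
  \<open>gap x / u\<^sup>3\<close> on the left, where it becomes the gap at the end of the epoch.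

  The constants come from Young's inequality with parameter \<open>\<beta> = 3 * L / u\<close> for the inner product of the
  drift with the mean gradient estimate \<open>v\<close>. The squared norm of \<open>v\<close> then has a nonpositive
  coefficient as soon as \<open>(L / 2 + c) * \<eta> + c / \<beta> \<le> 1 / 2\<close>, and the drift is absorbed as soon as
  \<open>(L / 2 + c) * \<eta>\<^sup>2 * L\<^sup>2 + c * \<eta> * \<beta> \<le> c / u\<^sup>3\<close>. Both hold with room to spare for \<open>c = L / (12 * u)\<close>.
\<close>

lemma one_step:
  assumes x: "x \<in> Rd d" and x0: "x0 \<in> Rd d" and g: "g \<in> Rd d" and u: "u \<ge> 1"
  defines "\<eta> \<equiv> 1 / (6 * L * u\<^sup>2)" and "c \<equiv> L / (12 * u)"
  defines "y \<equiv> \<lambda>i m. x m - \<eta> * (G i x m - G i x0 m + g m)"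
  shows "(\<Sum>i=1..n. gap (y i) + c * sqn d (\<lambda>m. y i m - x0 m)) / real n
       + (\<eta> / 2 * sqn d (gradF x) + gap x / u ^ 3)
     \<le> (1 + 1 / u ^ 3) * (gap x + c * sqn d (\<lambda>m. x m - x0 m))
       + \<eta> / 2 * sqn d (\<lambda>m. g m - gradF x0 m)"
proof -
  define \<beta> where "\<beta> = 3 * L / u"
  define \<nu> where "\<nu> = (\<lambda>i m. G i x m - G i x0 m + g m)"
  define v where "v = (\<lambda>m. gradF x m + (g m - gradF x0 m))"
  define w where "w = (\<lambda>m. x m - x0 m)"
  define P where "P = sqn d (gradF x)"
  define Q where "Q = sqn d v"
  define R where "R = sqn d (\<lambda>m. g m - gradF x0 m)"
  define W where "W = sqn d w"
  define M where "M = (\<Sum>i=1..n. sqn d (\<nu> i)) / real n"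
  have pos: "\<eta> > 0" "c > 0" "\<beta> > 0" using L_pos u by (auto simp: \<eta>_def c_def \<beta>_def)
  have n0: "real n > 0" using n_ge_1 by simp
  have \<nu>R: "\<nu> i \<in> Rd d" if "i \<in> {1..n}" for i
    using G_Rd[OF that x] G_Rd[OF that x0] g by (simp add: \<nu>_def Rd_def)
  have mean: "(\<Sum>i=1..n. \<nu> i m) = real n * v m" for m
    unfolding \<nu>_def v_def gradF_eq[OF x] gradF_eq[OF x0] using n0
    by (simp add: sum.distrib sum_subtractf field_simps)
  have ip_mean: "(\<Sum>i=1..n. ip d z (\<nu> i)) = real n * ip d z v" for z
    unfolding ip_def by (subst sum.swap) (simp add: mean[simplified] sum_distrib_left mult_ac flip: sum_distrib_left[of "z _"])
  \<comment> \<open>The estimates \<open>\<nu> i\<close> have mean \<open>v\<close>, and their variance is at most the mean square of the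
    gradient differences \<open>D i\<close>, which smoothness bounds by the drift.\<close>
  have M: "M \<le> Q + L\<^sup>2 * W"
  proof -
    define D where "D = (\<lambda>i m. G i x m - G i x0 m)"
    have "(\<Sum>i=1..n. (\<nu> i m)\<^sup>2) \<le> real n * (v m)\<^sup>2 + (\<Sum>i=1..n. (D i m)\<^sup>2)" for m
    proof -
      have "(\<Sum>i=1..n. (\<nu> i m)\<^sup>2)
          = (\<Sum>i=1..n. (D i m)\<^sup>2 + 2 * g m * \<nu> i m - (g m)\<^sup>2)"
        by (intro sum.cong) (auto simp: \<nu>_def D_def power2_eq_square algebra_simps)
      also have "\<dots> = (\<Sum>i=1..n. (D i m)\<^sup>2) + 2 * g m * (real n * v m) - real n * (g m)\<^sup>2"
        by (simp add: sum.distrib sum_subtractf mean[simplified] flip: sum_distrib_left)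
      also have "\<dots> = (\<Sum>i=1..n. (D i m)\<^sup>2) + real n * (v m)\<^sup>2 - real n * (v m - g m)\<^sup>2"
        by (simp add: power2_eq_square algebra_simps)
      finally show ?thesis by simp
    qed
    then have "(\<Sum>m<d. \<Sum>i=1..n. (\<nu> i m)\<^sup>2) \<le> (\<Sum>m<d. real n * (v m)\<^sup>2 + (\<Sum>i=1..n. (D i m)\<^sup>2))"
      by (intro sum_mono)
    also have "\<dots> = real n * Q + (\<Sum>m<d. \<Sum>i=1..n. (D i m)\<^sup>2)"
      by (simp add: sum.distrib Q_def sqn_def sum_distrib_left)
    finally have "(\<Sum>i=1..n. sqn d (\<nu> i)) \<le> real n * Q + (\<Sum>i=1..n. sqn d (D i))"
      unfolding sqn_def by (subst sum.swap, subst (2) sum.swap)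
    also have "(\<Sum>i=1..n. sqn d (D i)) \<le> (\<Sum>i=1..n. L\<^sup>2 * W)"
      unfolding D_def W_def w_def using x x0 by (intro sum_mono smooth_sq) auto
    finally show ?thesis unfolding M_def using n0 by (simp add: field_simps)
  qed
  have F: "(\<Sum>i=1..n. gap (y i)) / real n \<le> gap x - \<eta> * ip d (gradF x) v + L / 2 * \<eta>\<^sup>2 * M"
  proof -
    have "(\<Sum>i=1..n. gap (y i)) \<le> (\<Sum>i=1..n. gap x - \<eta> * ip d (gradF x) (\<nu> i) + L / 2 * \<eta>\<^sup>2 * sqn d (\<nu> i))"
    proof (rule sum_mono)
      fix i assume i: "i \<in> {1..n}"
      have "(\<lambda>m. - \<eta> * \<nu> i m) \<in> Rd d" using \<nu>R[OF i] by (simp add: Rd_def)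
      from gap_descent[OF x this]
      show "gap (y i) \<le> gap x - \<eta> * ip d (gradF x) (\<nu> i) + L / 2 * \<eta>\<^sup>2 * sqn d (\<nu> i)"
        unfolding ip_scale_right
        by (simp add: y_def \<nu>_def sqn_def power_mult_distrib sum_distrib_left mult_ac)
    qed
    also have "\<dots> = real n * (gap x - \<eta> * ip d (gradF x) v + L / 2 * \<eta>\<^sup>2 * M)"
      using n0 by (simp add: sum.distrib sum_subtractf ip_mean[simplified] M_def
          flip: sum_distrib_left sum_divide_distrib) (simp add: algebra_simps)
    finally show ?thesis using n0 by (simp add: field_simps)
  qed
  have D: "(\<Sum>i=1..n. sqn d (\<lambda>m. y i m - x0 m)) / real n = W - 2 * \<eta> * ip d w v + \<eta>\<^sup>2 * M"
  proof -
    have "sqn d (\<lambda>m. y i m - x0 m) = W - 2 * \<eta> * ip d w (\<nu> i) + \<eta>\<^sup>2 * sqn d (\<nu> i)" for i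
      unfolding W_def sqn_def ip_def sum_distrib_left
      by (simp add: y_def \<nu>_def w_def power2_eq_square algebra_simps flip: sum.distrib sum_subtractf)
    then have "(\<Sum>i=1..n. sqn d (\<lambda>m. y i m - x0 m)) = real n * (W - 2 * \<eta> * ip d w v + \<eta>\<^sup>2 * M)"
      using n0 by (simp add: sum.distrib sum_subtractf ip_mean[simplified] M_def
          flip: sum_distrib_left) (simp add: algebra_simps)
    then show ?thesis using n0 by simp
  qed
  have polar: "- 2 * ip d (gradF x) v = R - P - Q"
    unfolding ip_def R_def P_def Q_def sqn_def v_def sum_distrib_left sum_subtractf[symmetric]
    by (intro sum.cong) (auto simp: power2_eq_square algebra_simps)
  have young: "- 2 * ip d w v \<le> \<beta> * W + Q / \<beta>"
  proof -
    have "- 2 * (a * b) \<le> \<beta> * a\<^sup>2 + b\<^sup>2 / \<beta>" for a b :: real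
    proof -
      have "0 \<le> (\<beta> * a + b)\<^sup>2 / \<beta>" using pos by simp
      also have "\<dots> = \<beta> * a\<^sup>2 + b\<^sup>2 / \<beta> + 2 * (a * b)"
        using pos by (simp add: field_simps power2_eq_square)
      finally show ?thesis by simp
    qed
    then have "(\<Sum>m<d. - 2 * (w m * v m)) \<le> (\<Sum>m<d. \<beta> * (w m)\<^sup>2 + (v m)\<^sup>2 / \<beta>)"
      by (intro sum_mono)
    then show ?thesis
      by (simp add: ip_def W_def Q_def sqn_def sum.distrib sum_distrib_left sum_divide_distrib)
  qed
  have coefQ: "(L / 2 + c) * \<eta> + c / \<beta> \<le> 1 / 2"
  proof -
    have "c / \<beta> = 1 / 36" using u L_pos by (simp add: c_def \<beta>_def)
    moreover have "(L / 2 + c) * \<eta> \<le> L * (1 / (6 * L))"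
    proof (rule mult_mono)
      show "L / 2 + c \<le> L" using u L_pos by (simp add: c_def field_simps)
      show "\<eta> \<le> 1 / (6 * L)" unfolding \<eta>_def using u L_pos
        by (intro divide_left_mono) (auto simp: one_le_power)
    qed (use L_pos pos in auto)
    ultimately show ?thesis using L_pos by simp
  qed
  have coefW: "(L / 2 + c) * \<eta>\<^sup>2 * L\<^sup>2 + c * \<eta> * \<beta> \<le> c / u ^ 3"
  proof -
    have e1: "c * \<eta> * \<beta> = 18 / 432 * (L / u ^ 4)" and e3: "c / u ^ 3 = 36 / 432 * (L / u ^ 4)"
      using u L_pos by (auto simp: c_def \<eta>_def \<beta>_def field_simps power_numeral_reduce)
    have "(L / 2 + c) * \<eta>\<^sup>2 * L\<^sup>2 = (L / 2 + c) * (1 / (36 * u ^ 4))"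
      using u L_pos by (simp add: \<eta>_def field_simps power_numeral_reduce)
    also have "\<dots> \<le> (7 / 12 * L) * (1 / (36 * u ^ 4))"
      using u L_pos by (intro mult_right_mono) (auto simp: c_def field_simps)
    finally have "(L / 2 + c) * \<eta>\<^sup>2 * L\<^sup>2 \<le> 7 / 432 * (L / u ^ 4)" by simp
    moreover have "0 \<le> L / u ^ 4" using u L_pos by simp
    ultimately show ?thesis unfolding e1 e3 by linarith
  qed
  have "(\<Sum>i=1..n. gap (y i) + c * sqn d (\<lambda>m. y i m - x0 m)) / real n
      = (\<Sum>i=1..n. gap (y i)) / real n + c * ((\<Sum>i=1..n. sqn d (\<lambda>m. y i m - x0 m)) / real n)"
    by (simp add: sum.distrib add_divide_distrib flip: sum_distrib_left)
  also have "\<dots> \<le> gap x + \<eta> / 2 * (- 2 * ip d (gradF x) v) + c * W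
      + c * \<eta> * (- 2 * ip d w v) + (L / 2 + c) * \<eta>\<^sup>2 * M"
    using F unfolding D by (simp add: algebra_simps)
  also have "\<dots> \<le> gap x + \<eta> / 2 * (R - P - Q) + c * W
      + c * \<eta> * (\<beta> * W + Q / \<beta>) + (L / 2 + c) * \<eta>\<^sup>2 * (Q + L\<^sup>2 * W)"
    unfolding polar using young M pos L_pos
    by (intro add_mono mult_left_mono order.refl) auto
  also have "\<dots> = gap x + \<eta> / 2 * (R - P) + c * W
      + \<eta> * Q * ((L / 2 + c) * \<eta> + c / \<beta> - 1 / 2)
      + W * ((L / 2 + c) * \<eta>\<^sup>2 * L\<^sup>2 + c * \<eta> * \<beta>)"
    by (simp add: algebra_simps power2_eq_square add_divide_distrib diff_divide_distrib)
  also have "\<dots> \<le> gap x + \<eta> / 2 * (R - P) + c * W + \<eta> * Q * 0 + W * (c / u ^ 3)"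
    using coefQ coefW pos by (intro add_mono mult_left_mono order.refl) (auto simp: Q_def W_def)
  finally show ?thesis
    unfolding P_def[symmetric] R_def[symmetric] W_def[unfolded w_def, symmetric]
    by (simp add: algebra_simps add_divide_distrib diff_divide_distrib)
qed

section \<open>One epoch\<close>

lemma scsg_inner_Rd:
  assumes x0: "x0 \<in> Rd d" and g: "g \<in> Rd d" and b: "b \<le> n"
    and x: "x \<in> set_pmf (scsg_inner d n f \<eta> b g x0 k)"
  shows "x \<in> Rd d"
  using x
proof (induction k arbitrary: x)
  case 0
  then show ?case using x0 by simp
next
  case (Suc k)
  then obtain z I where z: "z \<in> Rd d" and I: "I \<subseteq> {1..n}"
    and eq: "x = (\<lambda>m. z m - \<eta> * (batch_grad d f I z m - batch_grad d f I x0 m + g m))"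
    using b by (auto simp: set_uniform_subset)
  show ?case
    using z g batch_grad_Rd[OF I z] batch_grad_Rd[OF I x0] unfolding eq by (simp add: Rd_def)
qed

text \<open>
  The one-step inequality, integrated over the law of the k-th inner iterate, is the hypothesis
  of the discounted telescoping. At the start of the epoch there is no drift, so the initial
  potential is the gap alone.
\<close>

lemma inner_loop_bound:
  fixes B :: nat
  assumes x0: "x0 \<in> Rd d" and g: "g \<in> Rd d" and B: "B \<ge> 1"
  defines "\<eta> \<equiv> 1 / (6 * L * real B powr (2/3))"
  shows "(\<integral>\<^sup>+N. \<integral>\<^sup>+x. ennreal (gap x + real B * \<eta> / 2 * sqn d (gradF x))
            \<partial>measure_pmf (scsg_inner d n f \<eta> 1 g x0 N) \<partial>measure_pmf (geometric_pmf (1 / (real B + 1))))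
       \<le> ennreal (gap x0 + real B * \<eta> / 2 * sqn d (\<lambda>m. g m - gradF x0 m))"
proof -
  define u where "u = real B powr (1/3)"
  have u: "u \<ge> 1" using B by (simp add: u_def ge_one_powr_ge_zero)
  have u3: "u ^ 3 = real B" using B by (simp add: u_def powr_powr flip: powr_realpow)
  have u2: "real B powr (2/3) = u\<^sup>2" using B by (simp add: u_def powr_powr flip: powr_realpow)
  have \<eta>: "\<eta> = 1 / (6 * L * u\<^sup>2)" unfolding \<eta>_def u2 ..
  have \<eta>0: "\<eta> > 0" using L_pos u by (simp add: \<eta>)
  have Bp: "real B > 0" using B by simp
  define c where "c = L / (12 * u)"
  have c: "c \<ge> 0" using L_pos u by (simp add: c_def)
  define \<Phi> where "\<Phi> = (\<lambda>x. gap x + c * sqn d (\<lambda>m. x m - x0 m))"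
  define \<Psi> where "\<Psi> = (\<lambda>x. \<eta> / 2 * sqn d (gradF x) + gap x / real B)"
  define \<mu> where "\<mu> = scsg_inner d n f \<eta> 1 g x0"
  define h where "h = \<eta> / 2 * sqn d (\<lambda>m. g m - gradF x0 m)"
  have \<Phi>0: "0 \<le> \<Phi> x" if "x \<in> Rd d" for x using gap_nonneg[OF that] c by (simp add: \<Phi>_def)
  have \<Psi>0: "0 \<le> \<Psi> x" if "x \<in> Rd d" for x using gap_nonneg[OF that] \<eta>0 by (simp add: \<Psi>_def)
  have h0: "0 \<le> h" using \<eta>0 by (simp add: h_def)
  have \<mu>R: "x \<in> Rd d" if "x \<in> set_pmf (\<mu> k)" for x k
    using scsg_inner_Rd[OF x0 g n_ge_1] that by (simp add: \<mu>_def)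
  have step: "(\<integral>\<^sup>+x. ennreal (\<Phi> x) \<partial>\<mu> (Suc k)) + (\<integral>\<^sup>+x. ennreal (\<Psi> x) \<partial>\<mu> k)
      \<le> ennreal (1 + 1 / real B) * (\<integral>\<^sup>+x. ennreal (\<Phi> x) \<partial>\<mu> k) + ennreal h" for k
  proof -
    define y where "y = (\<lambda>x I m. x m - \<eta> * (batch_grad d f I x m - batch_grad d f I x0 m + g m))"
    have y1: "y x {i} = (\<lambda>m. x m - \<eta> * (G i x m - G i x0 m + g m))" for x i
      by (simp add: y_def batch_grad_def)
    have yR: "y x {i} \<in> Rd d" if "x \<in> Rd d" "i \<in> {1..n}" for x i
      using that g G_Rd[OF that(2,1)] G_Rd[OF that(2) x0] by (simp add: y1 Rd_def)
    have "(\<integral>\<^sup>+x. ennreal (\<Phi> x) \<partial>\<mu> (Suc k)) + (\<integral>\<^sup>+x. ennreal (\<Psi> x) \<partial>\<mu> k)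
        = (\<integral>\<^sup>+x. (\<integral>\<^sup>+I. ennreal (\<Phi> (y x I)) \<partial>uniform_subset n 1) + ennreal (\<Psi> x) \<partial>\<mu> k)"
      by (subst nn_integral_add) (auto simp: \<mu>_def y_def)
    also have "\<dots> \<le> (\<integral>\<^sup>+x. ennreal (1 + 1 / real B) * ennreal (\<Phi> x) + ennreal h \<partial>\<mu> k)"
    proof (rule nn_integral_mono_AE, unfold AE_measure_pmf_iff, rule ballI)
      fix x assume "x \<in> set_pmf (\<mu> k)"
      then have x: "x \<in> Rd d" by (rule \<mu>R)
      have "(\<integral>\<^sup>+I. ennreal (\<Phi> (y x I)) \<partial>uniform_subset n 1) = ennreal ((\<Sum>i=1..n. \<Phi> (y x {i})) / real n)"
        using \<Phi>0 yR[OF x] n_ge_1 by (intro nn_integral_uniform_singleton) auto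
      moreover have "(\<Sum>i=1..n. \<Phi> (y x {i})) / real n + \<Psi> x \<le> (1 + 1 / real B) * \<Phi> x + h"
        using one_step[OF x x0 g u] unfolding \<Phi>_def \<Psi>_def h_def y1 \<eta> c_def u3 .
      moreover have "0 \<le> (\<Sum>i=1..n. \<Phi> (y x {i})) / real n"
        using \<Phi>0 yR[OF x] by (intro divide_nonneg_nonneg sum_nonneg) auto
      ultimately show "(\<integral>\<^sup>+I. ennreal (\<Phi> (y x I)) \<partial>uniform_subset n 1) + ennreal (\<Psi> x)
          \<le> ennreal (1 + 1 / real B) * ennreal (\<Phi> x) + ennreal h"
        using \<Phi>0[OF x] \<Psi>0[OF x] h0 by (simp flip: ennreal_plus ennreal_mult)
    qed
    also have "\<dots> = ennreal (1 + 1 / real B) * (\<integral>\<^sup>+x. ennreal (\<Phi> x) \<partial>\<mu> k) + ennreal h"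
      by (simp add: nn_integral_add nn_integral_cmult)
    finally show ?thesis .
  qed
  have \<Phi>x0: "\<Phi> x0 = gap x0" by (simp add: \<Phi>_def sqn_def)
  have "(\<integral>\<^sup>+N. \<integral>\<^sup>+x. ennreal (gap x + real B * \<eta> / 2 * sqn d (gradF x)) \<partial>\<mu> N \<partial>geometric_pmf (1 / (real B + 1)))
      = (\<integral>\<^sup>+N. ennreal (real B) * (\<integral>\<^sup>+x. ennreal (\<Psi> x) \<partial>\<mu> N) \<partial>geometric_pmf (1 / (real B + 1)))"
  proof (rule nn_integral_cong)
    fix N
    have "(\<integral>\<^sup>+x. ennreal (gap x + real B * \<eta> / 2 * sqn d (gradF x)) \<partial>\<mu> N)
        = (\<integral>\<^sup>+x. ennreal (real B) * ennreal (\<Psi> x) \<partial>\<mu> N)"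
      using \<Psi>0 \<mu>R Bp by (intro nn_integral_cong_AE)
        (auto simp: AE_measure_pmf_iff \<Psi>_def algebra_simps simp flip: ennreal_mult)
    then show "(\<integral>\<^sup>+x. ennreal (gap x + real B * \<eta> / 2 * sqn d (gradF x)) \<partial>\<mu> N)
        = ennreal (real B) * (\<integral>\<^sup>+x. ennreal (\<Psi> x) \<partial>\<mu> N)"
      by (simp add: nn_integral_cmult)
  qed
  also have "\<dots> = ennreal (real B) * (\<integral>\<^sup>+N. \<integral>\<^sup>+x. ennreal (\<Psi> x) \<partial>\<mu> N \<partial>geometric_pmf (1 / (real B + 1)))"
    by (simp add: nn_integral_cmult)
  also have "\<dots> \<le> ennreal (real B) * (ennreal (1 / real B) * (\<integral>\<^sup>+x. ennreal (\<Phi> x) \<partial>\<mu> 0) + ennreal h)"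
    using step by (intro mult_left_mono nn_integral_geometric_le[OF Bp]) auto
  also have "(\<integral>\<^sup>+x. ennreal (\<Phi> x) \<partial>\<mu> 0) = ennreal (gap x0)"
    by (simp add: \<mu>_def \<Phi>x0)
  also have "ennreal (real B) * (ennreal (1 / real B) * ennreal (gap x0) + ennreal h)
      = ennreal (real B * (1 / real B * gap x0 + h))"
    using Bp gap_nonneg[OF x0] h0 by (simp flip: ennreal_plus ennreal_mult)
  also have "real B * (1 / real B * gap x0 + h)
      = gap x0 + real B * \<eta> / 2 * sqn d (\<lambda>m. g m - gradF x0 m)"
    using Bp by (simp add: h_def algebra_simps)
  finally show ?thesis unfolding \<mu>_def .
qed

text \<open>
  The error of the large-batch gradient enters \<open>inner_loop_bound\<close> only through its squared norm,
  so averaging over the sampled batch leaves its mean square.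
\<close>

lemma epoch_bound:
  fixes B :: nat
  assumes x0: "x0 \<in> Rd d" and B: "1 \<le> B" "B \<le> n"
  defines "\<eta> \<equiv> 1 / (6 * L * real B powr (2/3))"
  shows "(\<integral>\<^sup>+p. ennreal (gap (fst p) + real B * \<eta> / 2 * sqn d (gradF (fst p)))
            \<partial>measure_pmf (scsg_epoch d n f \<eta> B 1 x0))
       \<le> ennreal (gap x0 + real B * \<eta> / 2 * (if B < n then H_star d n f / real B else 0))"
proof -
  define K where "K = {I. I \<subseteq> {1..n} \<and> card I = B}"
  define E where "E = (\<lambda>I. sqn d (\<lambda>m. batch_grad d f I x0 m - gradF x0 m))"
  define w where "w = real B * \<eta> / 2"
  have w: "w \<ge> 0" using L_pos by (simp add: w_def \<eta>_def)
  have cK: "card K = n choose B" unfolding K_def by (subst n_subsets) auto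
  then have K0: "real (card K) > 0" using B by simp
  have param: "1 - real B / (real B + real 1) = 1 / (real B + 1)" using B by (simp add: field_simps)
  have "(\<integral>\<^sup>+p. ennreal (gap (fst p) + w * sqn d (gradF (fst p))) \<partial>scsg_epoch d n f \<eta> B 1 x0)
      = (\<integral>\<^sup>+I. \<integral>\<^sup>+N. \<integral>\<^sup>+x. ennreal (gap x + w * sqn d (gradF x))
           \<partial>scsg_inner d n f \<eta> 1 (batch_grad d f I x0) x0 N
           \<partial>geometric_pmf (1 / (real B + 1)) \<partial>uniform_subset n B)"
    unfolding scsg_epoch_def param by simp
  also have "\<dots> \<le> (\<integral>\<^sup>+I. ennreal (gap x0 + w * E I) \<partial>uniform_subset n B)"
    unfolding w_def E_def \<eta>_def using x0 B
    by (intro nn_integral_mono_AE, unfold AE_measure_pmf_iff, intro ballI inner_loop_bound)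
      (auto simp: set_uniform_subset batch_grad_Rd)
  also have "\<dots> = ennreal ((\<Sum>I\<in>K. gap x0 + w * E I) / real (card K))"
    unfolding K_def using B gap_nonneg[OF x0] w by (intro nn_integral_uniform_subset) (auto simp: E_def)
  also have "(\<Sum>I\<in>K. gap x0 + w * E I) / real (card K) = gap x0 + w * ((\<Sum>I\<in>K. E I) / real (card K))"
    using K0 by (simp add: sum.distrib add_divide_distrib flip: sum_distrib_left)
  also have "ennreal \<dots> \<le> ennreal (gap x0 + w * (if B < n then H_star d n f / real B else 0))"
    using batch_gradient_error[OF B x0] w
    by (intro ennreal_leI add_left_mono mult_left_mono) (auto simp: K_def E_def)
  finally show ?thesis unfolding w_def .
qed

section \<open>The whole run\<close>

abbreviation run where
  "run \<equiv> scsg_run d n f (step_size L n) (batch_size n) minibatch_size"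

definition epoch_weight :: "nat \<Rightarrow> real" where
  "epoch_weight j = step_size L n j * real (batch_size n j)"

definition batch_error_bound :: "nat \<Rightarrow> real" where
  "batch_error_bound j = (if batch_size n j < n then H_star d n f / real (batch_size n j) else 0)"

lemma epoch_weight_pos: "j \<ge> 1 \<Longrightarrow> epoch_weight j > 0"
  using L_pos batch_size_bounds[OF n_ge_1, of j] by (simp add: epoch_weight_def step_size_def)

lemma batch_error_bound_nonneg: "batch_error_bound j \<ge> 0"
  using H_star_nonneg by (simp add: batch_error_bound_def)

lemma scsg_epoch_Rd:
  assumes "x0 \<in> Rd d" "B \<le> n" "b \<le> n" "p \<in> set_pmf (scsg_epoch d n f \<eta> B b x0)"
  shows "fst p \<in> Rd d"
proof -
  obtain I N x where "I \<subseteq> {1..n}" "x \<in> set_pmf (scsg_inner d n f \<eta> b (batch_grad d f I x0) x0 N)" "p = (x, N)"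
    using assms by (auto simp: scsg_epoch_def set_uniform_subset)
  then show ?thesis using scsg_inner_Rd[OF assms(1) batch_grad_Rd assms(3)] assms(1) by auto
qed

lemma run_Rd: "x0 \<in> Rd d \<Longrightarrow> \<omega> \<in> set_pmf (run x0 T) \<Longrightarrow> fst (\<omega> j) \<in> Rd d"
proof (induction T arbitrary: \<omega> j)
  case (Suc T)
  then obtain \<omega>' p where \<omega>': "\<omega>' \<in> set_pmf (run x0 T)" and \<omega>: "\<omega> = fun_upd \<omega>' (Suc T) p"
    and p: "p \<in> set_pmf (scsg_epoch d n f (step_size L n (Suc T)) (batch_size n (Suc T))
         (minibatch_size (Suc T)) (fst (\<omega>' T)))"
    by auto
  have "fst p \<in> Rd d"
    using scsg_epoch_Rd[OF _ _ _ p] Suc.IH[OF Suc.prems(1) \<omega>'] batch_size_bounds[OF n_ge_1, of "Suc T"] n_ge_1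
    by (simp add: minibatch_size_def)
  then show ?case using Suc.IH[OF Suc.prems(1) \<omega>'] by (simp add: \<omega>)
qed simp

text \<open>
  The epochs are chained by induction: the gap at the end of one epoch is the gap at the start of
  the next, so only the initial gap and the batch errors remain on the right.
\<close>

lemma run_bound:
  assumes x0: "x0 \<in> Rd d"
  shows "(\<integral>\<^sup>+\<omega>. ennreal (gap (fst (\<omega> T)) + (\<Sum>j=1..T. epoch_weight j / 2 * sqn d (gradF (fst (\<omega> j))))) \<partial>measure_pmf (run x0 T))
       \<le> ennreal (gap x0 + (\<Sum>j=1..T. epoch_weight j / 2 * batch_error_bound j))"
proof (induction T)
  case 0
  show ?case by simp
next
  case (Suc T)
  define S where "S = (\<lambda>\<omega> :: nat \<Rightarrow> (nat \<Rightarrow> real) \<times> nat. \<Sum>j=1..T. epoch_weight j / 2 * sqn d (gradF (fst (\<omega> j))))"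
  define E where "E = epoch_weight (Suc T) / 2 * batch_error_bound (Suc T)"
  define ep where "ep = scsg_epoch d n f (step_size L n (Suc T)) (batch_size n (Suc T)) 1"
  define V where "V = (\<lambda>x. gap x + epoch_weight (Suc T) / 2 * sqn d (gradF x))"
  have wS: "epoch_weight (Suc T) > 0" by (rule epoch_weight_pos) simp
  have S0: "S \<omega> \<ge> 0" for \<omega> unfolding S_def using epoch_weight_pos by (intro sum_nonneg) (simp add: less_imp_le)
  have V0: "V x \<ge> 0" if "x \<in> Rd d" for x using gap_nonneg[OF that] wS by (simp add: V_def)
  have E0: "E \<ge> 0" using wS batch_error_bound_nonneg by (simp add: E_def)
  have bnd: "1 \<le> batch_size n (Suc T)" "batch_size n (Suc T) \<le> n"
    using batch_size_bounds[OF n_ge_1, of "Suc T"] by auto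
  have split: "(\<Sum>j=1..Suc T. epoch_weight j / 2 * sqn d (gradF (fst ((fun_upd \<omega> (Suc T) p) j))))
      = S \<omega> + epoch_weight (Suc T) / 2 * sqn d (gradF (fst p))" for \<omega> p
  proof -
    have "(\<Sum>j=1..T. epoch_weight j / 2 * sqn d (gradF (fst ((fun_upd \<omega> (Suc T) p) j)))) = S \<omega>"
      unfolding S_def by (intro sum.cong) auto
    then show ?thesis by simp
  qed
  have "(\<integral>\<^sup>+\<omega>. ennreal (gap (fst (\<omega> (Suc T))) + (\<Sum>j=1..Suc T. epoch_weight j / 2 * sqn d (gradF (fst (\<omega> j))))) \<partial>run x0 (Suc T))
      = (\<integral>\<^sup>+\<omega>. \<integral>\<^sup>+p. ennreal (gap (fst p) + (S \<omega> + epoch_weight (Suc T) / 2 * sqn d (gradF (fst p)))) \<partial>ep (fst (\<omega> T)) \<partial>run x0 T)"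
    by (simp only: scsg_run.simps nn_integral_bind_pmf nn_integral_return_pmf zero_le split
        ep_def minibatch_size_def fun_upd_same)
  also have "\<dots> \<le> (\<integral>\<^sup>+\<omega>. ennreal (gap (fst (\<omega> T)) + S \<omega>) + ennreal E \<partial>run x0 T)"
  proof (rule nn_integral_mono_AE, unfold AE_measure_pmf_iff, rule ballI)
    fix \<omega> assume "\<omega> \<in> set_pmf (run x0 T)"
    then have R: "fst (\<omega> T) \<in> Rd d" by (rule run_Rd[OF x0])
    have epR: "fst p \<in> Rd d" if "p \<in> set_pmf (ep (fst (\<omega> T)))" for p
      using scsg_epoch_Rd[OF R bnd(2) n_ge_1] that by (simp add: ep_def)
    have "(\<integral>\<^sup>+p. ennreal (gap (fst p) + (S \<omega> + epoch_weight (Suc T) / 2 * sqn d (gradF (fst p)))) \<partial>ep (fst (\<omega> T)))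
        = (\<integral>\<^sup>+p. ennreal (S \<omega>) + ennreal (V (fst p)) \<partial>ep (fst (\<omega> T)))"
      using S0 V0 epR by (intro nn_integral_cong_AE)
        (auto simp: AE_measure_pmf_iff V_def algebra_simps simp flip: ennreal_plus)
    also have "\<dots> = ennreal (S \<omega>) + (\<integral>\<^sup>+p. ennreal (V (fst p)) \<partial>ep (fst (\<omega> T)))"
      by (simp add: nn_integral_add)
    also have "\<dots> \<le> ennreal (S \<omega>) + ennreal (gap (fst (\<omega> T)) + E)"
      using epoch_bound[OF R bnd]
      by (intro add_left_mono)
        (simp add: V_def E_def epoch_weight_def batch_error_bound_def ep_def step_size_def mult_ac)
    also have "\<dots> = ennreal (gap (fst (\<omega> T)) + S \<omega>) + ennreal E"
      using S0 gap_nonneg[OF R] E0 by (simp add: add_ac flip: ennreal_plus)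
    finally show "(\<integral>\<^sup>+p. ennreal (gap (fst p) + (S \<omega> + epoch_weight (Suc T) / 2 * sqn d (gradF (fst p)))) \<partial>ep (fst (\<omega> T)))
        \<le> ennreal (gap (fst (\<omega> T)) + S \<omega>) + ennreal E" .
  qed
  also have "\<dots> = (\<integral>\<^sup>+\<omega>. ennreal (gap (fst (\<omega> T)) + S \<omega>) \<partial>run x0 T) + ennreal E"
    by (simp add: nn_integral_add)
  also have "\<dots> \<le> ennreal (gap x0 + (\<Sum>j=1..T. epoch_weight j / 2 * batch_error_bound j)) + ennreal E"
    using Suc.IH unfolding S_def by (rule add_right_mono)
  also have "\<dots> = ennreal (gap x0 + (\<Sum>j=1..Suc T. epoch_weight j / 2 * batch_error_bound j))"
    using gap_nonneg[OF x0] epoch_weight_pos batch_error_bound_nonneg E0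
    by (subst ennreal_plus[symmetric])
      (auto simp: E_def add_ac less_imp_le intro!: add_nonneg_nonneg sum_nonneg mult_nonneg_nonneg)
  finally show ?case .
qed

lemma epoch_weight_eq: "j \<ge> 1 \<Longrightarrow> epoch_weight j = real (batch_size n j) powr (1/3) / (6 * L)"
proof -
  assume "j \<ge> 1"
  then have B: "real (batch_size n j) > 0" using batch_size_bounds[OF n_ge_1, of j] by simp
  have "real (batch_size n j) = real (batch_size n j) powr (1/3) * real (batch_size n j) powr (2/3)"
    using B by (simp flip: powr_add)
  then show ?thesis unfolding epoch_weight_def step_size_def using B L_pos
    by (simp add: field_simps)
qed

text \<open>
  The output index has the epoch weights as its unnormalised probabilities, so the expectation is
  the weighted gradient sum of \<open>run_bound\<close> divided by half the total weight; the factor \<open>6 * L\<close>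
  cancels except in front of the initial gap.
\<close>

lemma expected_sq_grad_bound:
  assumes x0: "x0 \<in> Rd d" and T: "T \<ge> 1"
  shows "expected_sq_grad d n f (step_size L n) (batch_size n) minibatch_size x0 T
       \<le> ennreal ((12 * (L * Delta_f d n f x0) + H_star d n f *
            (\<Sum>j=1..T. if batch_size n j < n then real (batch_size n j) powr (-2/3) else 0))
          / (\<Sum>j=1..T. real (batch_size n j) powr (1/3)))"
proof -
  define W where "W = sum epoch_weight {1..T}"
  define Q where "Q = (\<lambda>\<omega> :: nat \<Rightarrow> (nat \<Rightarrow> real) \<times> nat. \<Sum>j=1..T. epoch_weight j * sqn d (gradF (fst (\<omega> j))))"
  have W: "W > 0" unfolding W_def using T epoch_weight_pos by (intro sum_pos) auto
  have Q0: "Q \<omega> \<ge> 0" for \<omega>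
    unfolding Q_def using epoch_weight_pos by (intro sum_nonneg) (simp add: less_imp_le)
  have "(\<integral>\<^sup>+j. ennreal (sqn d (gradF (fst (\<omega> j)))) \<partial>output_index (step_size L n) (batch_size n) minibatch_size T)
      = ennreal (Q \<omega> / W)" for \<omega> :: "nat \<Rightarrow> (nat \<Rightarrow> real) \<times> nat"
    using nn_integral_output_index[OF T, of "step_size L n" "batch_size n" minibatch_size
        "\<lambda>j. sqn d (gradF (fst (\<omega> j)))"] epoch_weight_pos
    by (simp add: Q_def W_def minibatch_size_def flip: epoch_weight_def)
  then have "expected_sq_grad d n f (step_size L n) (batch_size n) minibatch_size x0 T
      = (\<integral>\<^sup>+\<omega>. ennreal (Q \<omega> / W) \<partial>run x0 T)"
    by (simp add: expected_sq_grad_def scsg_output_def enorm_sq)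
  also have "\<dots> \<le> (\<integral>\<^sup>+\<omega>. ennreal (2 / W) * ennreal (gap (fst (\<omega> T)) + (\<Sum>j=1..T. epoch_weight j / 2 * sqn d (gradF (fst (\<omega> j))))) \<partial>run x0 T)"
  proof (rule nn_integral_mono_AE, unfold AE_measure_pmf_iff, rule ballI)
    fix \<omega> assume "\<omega> \<in> set_pmf (run x0 T)"
    then have R: "gap (fst (\<omega> T)) \<ge> 0" by (intro gap_nonneg run_Rd[OF x0])
    have half: "(\<Sum>j=1..T. epoch_weight j / 2 * sqn d (gradF (fst (\<omega> j)))) = Q \<omega> / 2"
      by (simp add: Q_def sum_divide_distrib)
    have "Q \<omega> / W \<le> 2 / W * (gap (fst (\<omega> T)) + Q \<omega> / 2)"
      using R W by (simp add: field_simps)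
    then show "ennreal (Q \<omega> / W) \<le> ennreal (2 / W) * ennreal (gap (fst (\<omega> T)) + (\<Sum>j=1..T. epoch_weight j / 2 * sqn d (gradF (fst (\<omega> j)))))"
      unfolding half using W R Q0 by (simp add: ennreal_leI del: ennreal_plus flip: ennreal_mult)
  qed
  also have "\<dots> = ennreal (2 / W) * (\<integral>\<^sup>+\<omega>. ennreal (gap (fst (\<omega> T)) + (\<Sum>j=1..T. epoch_weight j / 2 * sqn d (gradF (fst (\<omega> j))))) \<partial>run x0 T)"
    by (simp add: nn_integral_cmult)
  also have "\<dots> \<le> ennreal (2 / W) * ennreal (gap x0 + (\<Sum>j=1..T. epoch_weight j / 2 * batch_error_bound j))"
    by (intro mult_left_mono run_bound[OF x0]) simp
  also have "\<dots> = ennreal (2 / W * (gap x0 + (\<Sum>j=1..T. epoch_weight j / 2 * batch_error_bound j)))"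
    using W by (subst ennreal_mult') auto
  also have "2 / W * (gap x0 + (\<Sum>j=1..T. epoch_weight j / 2 * batch_error_bound j))
      = (12 * (L * Delta_f d n f x0) + H_star d n f *
            (\<Sum>j=1..T. if batch_size n j < n then real (batch_size n j) powr (-2/3) else 0))
          / (\<Sum>j=1..T. real (batch_size n j) powr (1/3))"
  proof -
    define S where "S = (\<Sum>j=1..T. real (batch_size n j) powr (1/3))"
    define Z where "Z = (\<Sum>j=1..T. if batch_size n j < n then real (batch_size n j) powr (-2/3) else 0)"
    have WS: "W = S / (6 * L)"
      unfolding W_def S_def sum_divide_distrib by (intro sum.cong) (auto simp: epoch_weight_eq)
    have "(\<Sum>j=1..T. epoch_weight j / 2 * batch_error_bound j)
        = (\<Sum>j=1..T. H_star d n f / (12 * L) * (if batch_size n j < n then real (batch_size n j) powr (-2/3) else 0))"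
    proof (intro sum.cong refl)
      fix j assume j: "j \<in> {1..T}"
      then have B: "real (batch_size n j) > 0" using batch_size_bounds[OF n_ge_1, of j] by simp
      have "real (batch_size n j) powr (1/3) / real (batch_size n j) = real (batch_size n j) powr (-2/3)"
        using B by (simp add: powr_diff[of _ "1/3" 1, simplified] flip: powr_one)
      then have e: "real (batch_size n j) powr (-2/3) = real (batch_size n j) powr (1/3) / real (batch_size n j)"
        by simp
      show "epoch_weight j / 2 * batch_error_bound j
          = H_star d n f / (12 * L) * (if batch_size n j < n then real (batch_size n j) powr (-2/3) else 0)"
        unfolding e using j by (simp add: epoch_weight_eq batch_error_bound_def)
    qed
    also have "\<dots> = H_star d n f / (12 * L) * Z" by (simp add: Z_def sum_distrib_left)
    finally have sum: "(\<Sum>j=1..T. epoch_weight j / 2 * batch_error_bound j) = H_star d n f / (12 * L) * Z" .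
    have "gap x0 = Delta_f d n f x0" by (simp add: gap_def Delta_f_def)
    moreover have "S > 0" using W L_pos unfolding WS by (simp add: zero_less_divide_iff)
    ultimately show ?thesis
      unfolding sum WS S_def[symmetric] Z_def[symmetric] using L_pos by (simp add: field_simps)
  qed
  finally show ?thesis .
qed

end

section \<open>From accuracy to complexity\<close>

text \<open>
  The cube roots of the batch sizes grow like a truncated square root, which is concave and
  vanishes at 0; hence the j-th term is at least \<open>j / T\<close> times the bound for the last one.
\<close>

lemma sum_weights_ge:
  assumes n: "n \<ge> 1" and T: "T \<ge> 1"
  shows "real T * min (real T powr (3/2)) (real n) powr (1/3) / 2
       \<le> (\<Sum>j=1..T. real (batch_size n j) powr (1/3))"
proof -
  define y where "y = min (real T powr (3/2)) (real n)"
  have y: "y > 0" using n T by (simp add: y_def)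
  have summand: "real j / real T * y powr (1/3) \<le> real (batch_size n j) powr (1/3)" if j: "j \<in> {1..T}" for j
  proof -
    define q where "q = real j / real T"
    have q: "0 < q" "q \<le> 1" using j by (auto simp: q_def)
    have "q ^ 3 * y \<le> real (batch_size n j)"
    proof (cases "batch_size n j < n")
      case True
      have "q ^ 3 * y \<le> q powr (3/2) * real T powr (3/2)"
      proof (rule mult_mono)
        have "q ^ 3 = q powr 3" using q by simp
        also have "\<dots> \<le> q powr (3/2)" using q by (intro powr_mono') auto
        finally show "q ^ 3 \<le> q powr (3/2)" .
      qed (use y in \<open>auto simp: y_def\<close>)
      also have "\<dots> = real j powr (3/2)" using T by (simp add: q_def powr_divide)
      also have "\<dots> \<le> real (batch_size n j)" by (rule batch_size_ge[OF True])
      finally show ?thesis .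
    next
      case False
      then have "batch_size n j = n" using batch_size_bounds[OF n, of j] j by simp
      moreover have "q ^ 3 * y \<le> 1 * real n"
        using q y by (intro mult_mono) (auto simp: y_def power_le_one)
      ultimately show ?thesis by simp
    qed
    then have "(q ^ 3 * y) powr (1/3) \<le> real (batch_size n j) powr (1/3)"
      using q y by (intro powr_mono2) auto
    moreover have "(q ^ 3) powr (1/3) = q"
      using q by (simp add: powr_powr flip: powr_numeral)
    ultimately show ?thesis using q y by (simp add: powr_mult q_def)
  qed
  have "(\<Sum>j=1..T. real j) = real T * (real T + 1) / 2"
    by (induction T) (auto simp: field_simps)
  then have "(\<Sum>j=1..T. real j / real T * y powr (1/3)) = (real T + 1) / 2 * y powr (1/3)"
    using T by (simp only: flip: sum_distrib_right sum_divide_distrib) simp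
  moreover have "real T * y powr (1/3) / 2 \<le> (real T + 1) / 2 * y powr (1/3)"
    by (simp add: field_simps)
  moreover have "(\<Sum>j=1..T. real j / real T * y powr (1/3)) \<le> (\<Sum>j=1..T. real (batch_size n j) powr (1/3))"
    by (intro sum_mono summand)
  ultimately show ?thesis unfolding y_def by linarith
qed

text \<open>
  For \<open>n = 1\<close> every batch is the full sample and there is no error at all. This case has to be kept
  apart because the complexity bound contains \<open>ln n\<close>, which then vanishes.
\<close>

definition log_factor :: "nat \<Rightarrow> real \<Rightarrow> real" where
  "log_factor n y = (if n = 1 then 0 else 1 + 2 / 3 * ln y)"

text \<open>
  As long as the batch size stays below \<open>n\<close>, it is at least \<open>j\<^sup>3\<^sup>/\<^sup>2\<close>, and the j-th term is at most \<open>1 / j\<close>.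
  So this is a harmonic sum truncated where \<open>j\<^sup>3\<^sup>/\<^sup>2 = n\<close>.
\<close>

lemma sum_errors_le:
  assumes n: "n \<ge> 1" and T: "T \<ge> 1"
  shows "(\<Sum>j=1..T. if batch_size n j < n then real (batch_size n j) powr (-2/3) else 0)
       \<le> log_factor n (min (real T powr (3/2)) (real n))"
proof (cases "n = 1")
  case True
  have "batch_size n j = n" if "j \<in> {1..T}" for j
    using batch_size_bounds[OF n, of j] that True by simp
  then show ?thesis using True by (simp add: log_factor_def)
next
  case False
  have summand: "real (batch_size n j) powr (-2/3) \<le> 1 / real j" if "batch_size n j < n" "j \<ge> 1" for j
  proof -
    have "real (batch_size n j) powr (-2/3) \<le> (real j powr (3/2)) powr (-2/3)"
      using that batch_size_ge[OF that(1)] by (intro powr_mono2') auto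
    also have "\<dots> = 1 / real j" using that by (simp add: powr_powr powr_minus_divide)
    finally show ?thesis .
  qed
  show ?thesis using T
  proof (induction T rule: dec_induct)
    case base
    have "real (batch_size n 1) powr (-2/3) \<le> 1" if "batch_size n 1 < n" using summand[OF that] by simp
    then show ?case using False n unfolding atLeastAtMost_singleton by (simp add: log_factor_def)
  next
    case (step T)
    let ?y = "\<lambda>T. min (real T powr (3/2)) (real n)"
    have pos: "?y T > 0" "?y (Suc T) > 0" using step n by auto
    show ?case
    proof (cases "batch_size n (Suc T) < n")
      case True
      have lt: "real (Suc T) powr (3/2) < real n" using batch_size_ge[OF True] True by linarith
      moreover have "real T powr (3/2) \<le> real (Suc T) powr (3/2)" by (intro powr_mono2) auto
      ultimately have y: "?y T = real T powr (3/2)" "?y (Suc T) = real (Suc T) powr (3/2)" by auto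
      have "1 / real (Suc T) \<le> ln (real (Suc T)) - ln (real T)"
      proof -
        have "ln (real T / real (Suc T)) \<le> real T / real (Suc T) - 1"
          using step by (intro ln_le_minus_one) auto
        then show ?thesis using step by (simp add: ln_div field_simps)
      qed
      with summand[OF True] have "real (batch_size n (Suc T)) powr (-2/3) \<le> ln (real (Suc T)) - ln (real T)"
        by simp
      then show ?thesis using step.IH True False step(1) unfolding y log_factor_def
        by (simp add: ln_powr)
    next
      case notless: False
      have "ln (?y T) \<le> ln (?y (Suc T))"
      proof -
        have "real T powr (3/2) \<le> real (Suc T) powr (3/2)" by (intro powr_mono2) auto
        then have "?y T \<le> ?y (Suc T)" by linarith
        with pos show ?thesis by simp
      qed
      then show ?thesis using step.IH notless False unfolding log_factor_def by simp
    qed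
  qed
qed

text \<open>
  Let \<open>z\<close> be the threshold for \<open>y\<close> and \<open>l = max (ln h) 1\<close>. Then \<open>ln z \<le> 5 + 2 * l\<close>, and by concavity
  \<open>ln y \<le> ln z + y / z - 1\<close>; since \<open>l\<close> and \<open>y / z\<close> are at least 1, the left-hand side is at most a multiple
  of \<open>h * l * (y / z)\<close>, that is, of \<open>y\<close>. The factor 64 in the threshold makes this multiple small
  enough. The lemma turns an accuracy requirement containing \<open>ln y\<close> into an explicit threshold.
\<close>

lemma log_threshold:
  fixes h y :: real
  assumes h: "h > 0" and y: "y \<ge> 64 * (h * max (ln h) 1)"
  shows "4 * h * (1 + 2 / 3 * ln y) \<le> y"
proof -
  define l where "l = max (ln h) 1"
  define z where "z = 64 * (h * l)"
  define r where "r = y / z"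
  have l: "l \<ge> 1" "ln h \<le> l" by (auto simp: l_def)
  have z: "z > 0" using h l by (simp add: z_def)
  have r: "r \<ge> 1" using y z by (simp add: r_def z_def l_def)
  have yrz: "y = r * z" using z by (simp add: r_def)
  have "ln (64::real) = 6 * ln 2" using ln_realpow[of 2 6] by simp
  then have "ln (64::real) \<le> 6" using ln_2_less_1 by simp
  moreover have "ln z = ln 64 + (ln h + ln l)" using h l by (simp add: z_def ln_mult)
  moreover have "ln l \<le> l - 1" using l by (intro ln_le_minus_one) auto
  ultimately have "ln z \<le> 5 + 2 * l" using l by linarith
  moreover have "ln r \<le> r - 1" using r by (intro ln_le_minus_one) auto
  moreover have "ln y = ln r + ln z" using r z by (simp add: yrz ln_mult)
  ultimately have "1 + 2 / 3 * ln y \<le> 11 / 3 + 4 / 3 * l + 2 / 3 * r" by linarith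
  moreover have "1 \<le> l * r" "l \<le> l * r" "r \<le> l * r"
    using l r mult_mono[of 1 l 1 r] by auto
  ultimately have "1 + 2 / 3 * ln y \<le> 16 * (l * r)" by linarith
  then have "4 * h * (1 + 2 / 3 * ln y) \<le> 4 * h * (16 * (l * r))"
    using h by (intro mult_left_mono) auto
  also have "\<dots> = y" by (simp add: yrz z_def)
  finally show ?thesis .
qed

text \<open>
  The two regimes are separated by the threshold \<open>Y\<close> for \<open>min T\<^sup>3\<^sup>/\<^sup>2 n\<close>. Its constants give half of
  \<open>\<epsilon>\<close> to each of the two terms in the numerator of the accuracy bound: \<open>24 * D / y \<le> \<epsilon> / 2\<close> for \<open>y \<ge> 48 * D / \<epsilon>\<close>,
  and \<open>log_threshold\<close> is applied to \<open>h = H / \<epsilon>\<close>. The final constant is \<open>32 * (1 + 1024)\<close>, where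
  \<open>1024 = 64\<^sup>5\<^sup>/\<^sup>3\<close> comes from \<open>Y\<^sup>5\<^sup>/\<^sup>3\<close> and 32 from rounding up the number of epochs and the batch sizes.
\<close>

lemma complexity_estimate:
  fixes n :: nat and D H \<epsilon> :: real
  assumes n: "n \<ge> 1" and D: "D \<ge> 0" and H: "H \<ge> 0" and \<epsilon>: "\<epsilon> > 0"
  defines "R \<equiv> \<lambda>T. (12 * D + H * (\<Sum>j=1..T. if batch_size n j < n then real (batch_size n j) powr (-2/3) else 0))
          / (\<Sum>j=1..T. real (batch_size n j) powr (1/3))"
  obtains T where "T \<ge> 1" "\<And>T'. T' \<ge> T \<Longrightarrow> R T' \<le> \<epsilon>"
    "(\<Sum>j=1..T. 2 * real (batch_size n j)) \<le> 32800 * max (complexity_bound n 1 D H \<epsilon>) 1"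
proof -
  define l where "l = max (ln (H / \<epsilon>)) 1"
  define Y where "Y = max 1 (max (48 * (D / \<epsilon>)) (64 * (H / \<epsilon> * l)))"
  define A where "A = 1 / \<epsilon> powr (5/3) * (D powr (5/3) + H powr (5/3) * l ^ 5)"
  define rest where "rest = real n powr (2/3) / \<epsilon> * (D + H * ln (real n))"
  define m where "m = min A (real n powr (5/3))"
  define y where "y = (\<lambda>T. min (real T powr (3/2)) (real n))"
  have cb: "complexity_bound n 1 D H \<epsilon> = m + rest"
    by (simp add: complexity_bound_def m_def A_def rest_def l_def)
  have l: "l \<ge> 1" by (simp add: l_def)
  have A0: "A \<ge> 0" using l by (simp add: A_def)
  have lnn: "ln (real n) \<ge> 0" using n by simp
  have rest0: "rest \<ge> 0" using D H \<epsilon> lnn by (simp add: rest_def)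
  have m0: "m \<ge> 0" using A0 by (simp add: m_def)
  define X where "X = max (complexity_bound n 1 D H \<epsilon>) 1"
  have bound: "m + rest \<le> X" "1 \<le> X" by (simp_all add: X_def cb)
  have Y1: "Y \<ge> 1" by (simp add: Y_def)
  have YA: "Y powr (5/3) \<le> 1 + 1024 * A"
  proof -
    have c64: "(64::real) powr (5/3) = 1024"
    proof -
      have "(64::real) = 4 powr 3" by simp
      then have "(64::real) powr (5/3) = 4 powr 5" by (simp only: powr_powr) simp
      then show ?thesis by simp
    qed
    have DA: "(D / \<epsilon>) powr (5/3) \<le> A"
    proof -
      have "(D / \<epsilon>) powr (5/3) = 1 / \<epsilon> powr (5/3) * D powr (5/3)"
        using D \<epsilon> by (simp add: powr_divide)
      also have "\<dots> \<le> A" unfolding A_def using l by (intro mult_left_mono) auto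
      finally show ?thesis .
    qed
    have HA: "(H / \<epsilon> * l) powr (5/3) \<le> A"
    proof -
      have "l powr (5/3) \<le> l powr 5" using l by (intro powr_mono) auto
      then have "l powr (5/3) \<le> l ^ 5" using l by simp
      then have "H powr (5/3) * l powr (5/3) \<le> D powr (5/3) + H powr (5/3) * l ^ 5"
        by (intro add_increasing mult_left_mono) auto
      moreover have "(H / \<epsilon> * l) powr (5/3) = 1 / \<epsilon> powr (5/3) * (H powr (5/3) * l powr (5/3))"
        using H \<epsilon> l by (simp add: powr_divide powr_mult)
      ultimately show ?thesis unfolding A_def by (simp only:) (intro mult_left_mono, auto)
    qed
    have "(48 * (D / \<epsilon>)) powr (5/3) \<le> (64 * (D / \<epsilon>)) powr (5/3)"
      using D \<epsilon> by (intro powr_mono2) (auto intro!: divide_right_mono)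
    then have "(48 * (D / \<epsilon>)) powr (5/3) \<le> 1024 * A"
      using DA powr_mult[of 64 "D / \<epsilon>" "5/3"] unfolding c64 by linarith
    moreover have "(64 * (H / \<epsilon> * l)) powr (5/3) \<le> 1024 * A"
      using HA powr_mult[of 64 "H / \<epsilon> * l" "5/3"] unfolding c64 by linarith
    ultimately show ?thesis using A0 unfolding Y_def max_def by auto
  qed
  have R_le: "R T \<le> 2 * (12 * D + H * log_factor n (y T)) / (real T * y T powr (1/3))"
    and y_pos: "1 \<le> y T" if T: "T \<ge> 1" for T
  proof -
    show y1: "1 \<le> y T" using T n by (simp add: y_def ge_one_powr_ge_zero)
    have "R T \<le> (12 * D + H * log_factor n (y T)) / (\<Sum>j=1..T. real (batch_size n j) powr (1/3))"
      unfolding R_def y_def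
      by (intro divide_right_mono add_left_mono mult_left_mono sum_errors_le n T H sum_nonneg) auto
    also have "\<dots> \<le> (12 * D + H * log_factor n (y T)) / (real T * y T powr (1/3) / 2)"
    proof (rule frac_le[OF _ order.refl])
      show "real T * y T powr (1/3) / 2 \<le> (\<Sum>j=1..T. real (batch_size n j) powr (1/3))"
        unfolding y_def by (rule sum_weights_ge[OF n T])
      have "log_factor n (y T) \<ge> 0" using y1 by (simp add: log_factor_def)
      then show "0 \<le> 12 * D + H * log_factor n (y T)" using D H by simp
      show "0 < real T * y T powr (1/3) / 2" using T y1 by simp
    qed
    finally show "R T \<le> 2 * (12 * D + H * log_factor n (y T)) / (real T * y T powr (1/3))"
      by (simp add: mult.commute)
  qed
  show thesis
  proof (cases "Y \<le> real n")
    case True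
    \<comment> \<open>The accuracy is reached before the batches are full, up to rounding.\<close>
    define T where "T = nat \<lceil>Y powr (2/3)\<rceil>"
    have Yp: "Y powr (2/3) \<ge> 1" using Y1 by (simp add: ge_one_powr_ge_zero)
    have TY: "real T \<ge> Y powr (2/3)" by (simp add: T_def of_nat_ceiling)
    have T1: "T \<ge> 1" using TY Yp by linarith
    have T2: "real T \<le> 2 * Y powr (2/3)"
      using Yp unfolding T_def by linarith
    have acc: "R T' \<le> \<epsilon>" if "T' \<ge> T" for T'
    proof -
      have T'1: "T' \<ge> 1" using that T1 by simp
      have "Y = (Y powr (2/3)) powr (3/2)" using Y1 by (simp add: powr_powr)
      also have "\<dots> \<le> real T' powr (3/2)" using TY that by (intro powr_mono2) auto
      finally have yY: "y T' \<ge> Y" using True by (simp add: y_def)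
      have yp: "y T' \<ge> 1" using yY Y1 by simp
      have log0: "log_factor n (y T') \<ge> 0" "log_factor n (y T') \<le> 1 + 2/3 * ln (y T')"
        using yp by (auto simp: log_factor_def)
      have "y T' = y T' powr (2/3) * y T' powr (1/3)" using yp by (simp flip: powr_add)
      also have "\<dots> \<le> (real T' powr (3/2)) powr (2/3) * y T' powr (1/3)"
        using yp by (intro mult_right_mono powr_mono2) (auto simp: y_def)
      also have "\<dots> = real T' * y T' powr (1/3)" using T'1 by (simp add: powr_powr)
      finally have Ty: "y T' \<le> real T' * y T' powr (1/3)" .
      have dD: "24 * D \<le> \<epsilon> * y T' / 2"
      proof -
        have "48 * (D / \<epsilon>) \<le> y T'" using yY by (simp add: Y_def)
        then show ?thesis using \<epsilon> by (simp add: field_simps)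
      qed
      have dH: "2 * (H * log_factor n (y T')) \<le> \<epsilon> * y T' / 2"
      proof (cases "H = 0")
        case True
        then show ?thesis using \<epsilon> yp by simp
      next
        case False
        then have h: "H / \<epsilon> > 0" using H \<epsilon> by simp
        have "64 * (H / \<epsilon> * max (ln (H / \<epsilon>)) 1) \<le> y T'" using yY by (simp add: Y_def l_def)
        from log_threshold[OF h this]
        have "4 * H * (1 + 2 / 3 * ln (y T')) \<le> \<epsilon> * y T'" using \<epsilon> by (simp add: field_simps)
        moreover have "H * log_factor n (y T') \<le> H * (1 + 2/3 * ln (y T'))"
          using H log0 by (intro mult_left_mono) auto
        ultimately show ?thesis by linarith
      qed
      have "R T' \<le> 2 * (12 * D + H * log_factor n (y T')) / (real T' * y T' powr (1/3))"
        by (rule R_le[OF T'1])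
      also have "\<dots> \<le> 2 * (12 * D + H * log_factor n (y T')) / y T'"
        using Ty yp D H log0 by (intro divide_left_mono) auto
      also have "\<dots> \<le> \<epsilon>" using dD dH yp by (simp add: field_simps)
      finally show ?thesis .
    qed
    have "(\<Sum>j=1..T. 2 * real (batch_size n j)) \<le> (\<Sum>j=1..T. 4 * real T powr (3/2))"
    proof (rule sum_mono)
      fix j assume j: "j \<in> {1..T}"
      have "real (batch_size n j) \<le> real (nat \<lceil>real j powr (3/2)\<rceil>)"
        unfolding batch_size_def of_nat_le_iff by (rule min.cobounded1)
      also have "\<dots> \<le> real j powr (3/2) + 1" by (simp add: of_nat_nat)
      also have "\<dots> \<le> 2 * real T powr (3/2)"
      proof -
        have "real j powr (3/2) \<le> real T powr (3/2)" using j by (intro powr_mono2) auto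
        moreover have "1 \<le> real T powr (3/2)" using T1 by (simp add: ge_one_powr_ge_zero)
        ultimately show ?thesis by linarith
      qed
      finally show "2 * real (batch_size n j) \<le> 4 * real T powr (3/2)" by simp
    qed
    also have "\<dots> = 4 * real T powr (5/2)"
    proof -
      have "real T * real T powr (3/2) = real T powr (1 + 3/2)" using T1 by (subst powr_add) simp
      then show ?thesis by simp
    qed
    also have "\<dots> \<le> 4 * (2 * Y powr (2/3)) powr (5/2)"
      using T2 by (intro mult_left_mono powr_mono2) auto
    also have "(2 * Y powr (2/3)) powr (5/2) = 2 powr (5/2) * Y powr (5/3)"
      using Y1 by (simp add: powr_mult powr_powr)
    also have "4 * (2 powr (5/2) * Y powr (5/3)) \<le> 4 * (8 * Y powr (5/3))"
    proof -
      have "(2::real) powr (5/2) \<le> 2 powr 3" by (intro powr_mono) auto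
      then show ?thesis by (intro mult_left_mono mult_right_mono) auto
    qed
    also have "\<dots> \<le> 4 * (8 * (1 + 1024 * m))"
    proof -
      have "Y powr (5/3) \<le> real n powr (5/3)" using True Y1 by (intro powr_mono2) auto
      then have "Y powr (5/3) \<le> 1 + 1024 * real n powr (5/3)"
        using powr_ge_zero[of "real n" "5/3"] by linarith
      with YA have "Y powr (5/3) \<le> 1 + 1024 * m" by (simp add: m_def min_def)
      then show ?thesis by simp
    qed
    also have "\<dots> \<le> 32800 * max (complexity_bound n 1 D H \<epsilon>) 1"
      unfolding X_def[symmetric] using bound m0 rest0 by simp
    finally have cost: "(\<Sum>j=1..T. 2 * real (batch_size n j)) \<le> 32800 * max (complexity_bound n 1 D H \<epsilon>) 1" .
    show thesis using T1 acc cost by (rule that)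
  next
    case False
    \<comment> \<open>The batches become full first; \<open>Z\<close> is the number of epochs after which the full-batch
      bound, which decays like \<open>1 / T\<close>, is at most \<open>\<epsilon>\<close>.\<close>
    define v where "v = log_factor n (real n)"
    define Z where "Z = (24 * D + 2 * (H * v)) / (real n powr (1/3) * \<epsilon>)"
    define T where "T = nat \<lceil>max (real n powr (2/3)) Z\<rceil>"
    have n0: "real n > 0" using n by simp
    have v0: "v \<ge> 0" using lnn by (simp add: v_def log_factor_def)
    have v3: "v \<le> 3 * ln (real n)"
    proof (cases "n = 1")
      case False
      then have "ln (real n) \<ge> ln 2" using n by simp
      then have "ln (real n) \<ge> 1 / 2" using ln2_ge_two_thirds by linarith
      then show ?thesis using False by (simp add: v_def log_factor_def)
    qed (simp add: v_def log_factor_def)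
    have Z0: "Z \<ge> 0" using D H v0 \<epsilon> by (simp add: Z_def)
    have np: "real n powr (2/3) \<ge> 1" using n by (simp add: ge_one_powr_ge_zero)
    have Tn: "real T \<ge> real n powr (2/3)" and TZ: "real T \<ge> Z"
      using of_nat_ceiling[of "max (real n powr (2/3)) Z"] by (auto simp: T_def)
    have T1: "T \<ge> 1" using Tn np by linarith
    have Tle: "real T \<le> real n powr (2/3) + Z + 1"
      using np Z0 unfolding T_def by linarith
    have acc: "R T' \<le> \<epsilon>" if "T' \<ge> T" for T'
    proof -
      have T'1: "T' \<ge> 1" using that T1 by simp
      have "real n = (real n powr (2/3)) powr (3/2)" using n0 by (simp add: powr_powr)
      also have "\<dots> \<le> real T' powr (3/2)" using Tn that by (intro powr_mono2) auto
      finally have yn: "y T' = real n" by (simp add: y_def)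
      have "Z \<le> real T'" using TZ that by linarith
      then have "24 * D + 2 * (H * v) \<le> \<epsilon> * (real T' * real n powr (1/3))"
        unfolding Z_def using \<epsilon> n0 by (simp add: field_simps)
      moreover have "R T' \<le> 2 * (12 * D + H * v) / (real T' * real n powr (1/3))"
        using R_le[OF T'1] by (simp add: yn v_def)
      moreover have "2 * (12 * D + H * v) / (real T' * real n powr (1/3)) \<le> \<epsilon>"
        if "24 * D + 2 * (H * v) \<le> \<epsilon> * (real T' * real n powr (1/3))"
        using that T'1 n0 by (subst pos_divide_le_eq) auto
      ultimately show ?thesis by linarith
    qed
    have "(\<Sum>j=1..T. 2 * real (batch_size n j)) \<le> (\<Sum>j=1..T. 2 * real n)"
      by (intro sum_mono) (simp add: batch_size_def)
    also have "\<dots> = 2 * real n * real T" by simp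
    also have "\<dots> \<le> 2 * real n * (real n powr (2/3) + Z + 1)"
      using Tle n0 by (intro mult_left_mono) auto
    also have "\<dots> \<le> 2 * real n * (2 * real n powr (2/3) + Z)"
      using np n0 by (intro mult_left_mono) auto
    also have "\<dots> = 4 * real n powr (5/3) + 2 * (real n * Z)"
    proof -
      have "real n * real n powr (2/3) = real n powr (1 + 2/3)" using n0 by (subst powr_add) simp
      then show ?thesis by (simp add: algebra_simps)
    qed
    also have "real n * Z = real n powr (2/3) / \<epsilon> * (24 * D + 2 * (H * v))"
    proof -
      have "real n = real n powr (2/3) * real n powr (1/3)" using n0 by (simp flip: powr_add)
      then have "real n * Z = real n powr (2/3) * (real n powr (1/3) * Z)" by simp
      also have "real n powr (1/3) * Z = (24 * D + 2 * (H * v)) / \<epsilon>"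
        using n0 by (simp add: Z_def)
      finally show ?thesis by simp
    qed
    also have "\<dots> \<le> real n powr (2/3) / \<epsilon> * (24 * (D + H * ln (real n)))"
    proof (intro mult_left_mono)
      have "H * v \<le> H * (3 * ln (real n))" using v3 H by (rule mult_left_mono)
      moreover have "0 \<le> H * ln (real n)" using H lnn by simp
      ultimately show "24 * D + 2 * (H * v) \<le> 24 * (D + H * ln (real n))" by simp
    qed (use \<epsilon> in auto)
    also have "\<dots> = 24 * rest" by (simp add: rest_def)
    finally have "(\<Sum>j=1..T. 2 * real (batch_size n j)) \<le> 4 * real n powr (5/3) + 48 * rest" by simp
    moreover have "real n powr (5/3) \<le> 1 + 1024 * m"
    proof -
      have "real n powr (5/3) \<le> Y powr (5/3)" using False by (intro powr_mono2) auto
      then have "real n powr (5/3) \<le> 1 + 1024 * A" using YA by linarith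
      moreover have "real n powr (5/3) \<le> 1 + 1024 * real n powr (5/3)"
        using powr_ge_zero[of "real n" "5/3"] by linarith
      ultimately show ?thesis by (simp only: m_def min_def simp_thms split: if_split)
    qed
    ultimately have cost: "(\<Sum>j=1..T. 2 * real (batch_size n j)) \<le> 32800 * max (complexity_bound n 1 D H \<epsilon>) 1"
      unfolding X_def[symmetric] using bound m0 rest0 by linarith
    show thesis using T1 acc cost by (rule that)
  qed
qed

theorem corollary3p4:
  "\<exists>C::real. C > 0 \<and>
     (\<forall>(d::nat) (n::nat) (f :: nat \<Rightarrow> (nat \<Rightarrow> real) \<Rightarrow> real) (L::real) (x0 :: nat \<Rightarrow> real) (\<epsilon>::real).
        n \<ge> 1 \<longrightarrow> L > 0 \<longrightarrow> \<epsilon> > 0 \<longrightarrow> x0 \<in> Rd d \<longrightarrow>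
        (\<forall>i\<in>{1..n}. \<forall>x\<in>Rd d. differentiable_at d (f i) x) \<longrightarrow>
        (\<forall>i\<in>{1..n}. \<forall>x\<in>Rd d. \<forall>y\<in>Rd d.
           enorm d (\<lambda>m. grad d (f i) x m - grad d (f i) y m) \<le> L * enorm d (\<lambda>m. x m - y m)) \<longrightarrow>
        bdd_below (objective n f ` Rd d) \<longrightarrow>
        bdd_above (grad_variance d n f ` Rd d) \<longrightarrow>
        expected_comp_cost d n f (step_size L n) (batch_size n) minibatch_size x0 \<epsilon>
          \<le> ennreal (C * max (complexity_bound n L (Delta_f d n f x0) (H_star d n f) \<epsilon>) 1))"
proof (intro exI[of _ "32800 :: real"] conjI allI impI)
  fix d n :: nat and f :: "nat \<Rightarrow> (nat \<Rightarrow> real) \<Rightarrow> real" and L :: real and x0 :: "nat \<Rightarrow> real" and \<epsilon> :: real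
  assume n: "n \<ge> 1" and L: "L > 0" and \<epsilon>: "\<epsilon> > 0" and x0: "x0 \<in> Rd d"
    and problem: "\<forall>i\<in>{1..n}. \<forall>x\<in>Rd d. differentiable_at d (f i) x"
      "\<forall>i\<in>{1..n}. \<forall>x\<in>Rd d. \<forall>y\<in>Rd d.
           enorm d (\<lambda>m. grad d (f i) x m - grad d (f i) y m) \<le> L * enorm d (\<lambda>m. x m - y m)"
      "bdd_below (objective n f ` Rd d)" "bdd_above (grad_variance d n f ` Rd d)"
  define D where "D = L * Delta_f d n f x0"
  have D: "D \<ge> 0" using Delta_f_nonneg[OF n L problem x0] L by (simp add: D_def)
  have cb: "complexity_bound n 1 D (H_star d n f) \<epsilon> = complexity_bound n L (Delta_f d n f x0) (H_star d n f) \<epsilon>"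
    by (simp add: complexity_bound_def D_def)
  obtain T where T1: "T \<ge> 1" and acc: "\<And>T'. T' \<ge> T \<Longrightarrow>
      (12 * D + H_star d n f * (\<Sum>j=1..T'. if batch_size n j < n then real (batch_size n j) powr (-2/3) else 0))
          / (\<Sum>j=1..T'. real (batch_size n j) powr (1/3)) \<le> \<epsilon>"
    and cost: "(\<Sum>j=1..T. 2 * real (batch_size n j)) \<le> 32800 * max (complexity_bound n 1 D (H_star d n f) \<epsilon>) 1"
    by (rule complexity_estimate[OF n D H_star_nonneg[OF n L problem] \<epsilon>], rule that; blast)
  have "expected_sq_grad d n f (step_size L n) (batch_size n) minibatch_size x0 T' \<le> ennreal \<epsilon>" if "T' \<ge> T" for T'
    using expected_sq_grad_bound[OF n L problem x0, of T'] acc[OF that] T1 that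
    by (auto simp: D_def intro: order_trans ennreal_leI)
  then have "T_eps d n f (step_size L n) (batch_size n) minibatch_size x0 \<epsilon> \<le> enat T"
    unfolding T_eps_def using T1 by (intro INF_lower) auto
  then obtain S where S: "T_eps d n f (step_size L n) (batch_size n) minibatch_size x0 \<epsilon> = enat S" "S \<le> T"
    by (cases "T_eps d n f (step_size L n) (batch_size n) minibatch_size x0 \<epsilon>") auto
  have "expected_comp_cost d n f (step_size L n) (batch_size n) minibatch_size x0 \<epsilon>
      \<le> ennreal (\<Sum>j=1..S. 2 * real (batch_size n j))"
    unfolding expected_comp_cost_def S enat.case
    by (rule expected_total_cost_le) (use batch_size_bounds[OF n] in blast)
  also have "\<dots> \<le> ennreal (\<Sum>j=1..T. 2 * real (batch_size n j))"
    using S(2) by (intro ennreal_leI sum_mono2) auto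
  also have "\<dots> \<le> ennreal (32800 * max (complexity_bound n L (Delta_f d n f x0) (H_star d n f) \<epsilon>) 1)"
    using cost unfolding cb by (rule ennreal_leI)
  finally show "expected_comp_cost d n f (step_size L n) (batch_size n) minibatch_size x0 \<epsilon>
      \<le> ennreal (32800 * max (complexity_bound n L (Delta_f d n f x0) (H_star d n f) \<epsilon>) 1)" .
qed simp

end
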